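(* Let $R$ be a commutative ring with $1$, let $M$ be an $\omega$-categorical Ramsey structure, let $G=\mathrm{Aut}(M)$, and let $W$ be a sort in $M^{eq}$. Let $x, v_1,\ldots,v_r\in RW$, and let $S\subseteq W$ be the (finite) support of $x$. Let $W_1,\ldots,W_\ell$ be the (finitely many) $G_{(S)}$-orbits on $W$ and define $\Omega_S: RW\to R^\ell$ by $$\Omega_S\Big(\sum_{w\in W}\gamma_w w\Big)=\Big(\sum_{w\in W_1}\gamma_w,\ldots,\sum_{w\in W_\ell}\gamma_w\Big).$$ Let $u_1,\ldots,u_t$ be representatives for the (finitely many) $G_{(S)}$-orbits on the union of the $G$-orbits on $RW$ containing $v_1,\ldots,v_r$. Then $$x\in\langle v_1,\ldots,v_r\rangle_{RG}\iff \Omega_S(x)\in\langle\Omega_S(u_1),\ldots,\Omega_S(u_t)\rangle_R,$$ where $\langle\cdot\rangle_{RG}$ denotes the $RG$-submodule of $RW$ generated by the given elements and $\langle\cdot\rangle_R$ the $R$-submodule of $R^\ell$ generated by the given elements.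
   Context: $RW$ is the free $R$-module with basis $W$, with $G$ acting by extending its permutation action on $W$ linearly. The support of $\sum_w\alpha_w w\in RW$ is the finite set $\{w:\alpha_w\ne 0\}$. For a set $A$ on which $G$ acts or a subset of a $G$-set, $G_{(A)}$ denotes the pointwise stabiliser $\{g\in G: ga=a \text{ for all } a\in A\}$. $M^{eq}$: the imaginary elements of $M$, i.e. equivalence classes of $\emptyset$-definable equivalence relations $E$ on $\emptyset$-definable subsets $D\subseteq M^n$ ($n\in\mathbb{N}$); $G$ acts on $M^{eq}$. Up to interdefinability, a sort in $M^{eq}$ is the same as a finite union of $G$-orbits on $M^{eq}$ (for example $M^n$). $M$ countably infinite is $\omega$-categorical iff $\mathrm{Aut}(M)$ has finitely many orbits on $M^n$ for all $n$. A Ramsey structure is a countable Fraïssé structure $M$ (locally finite, every isomorphism between finite substructures extends to an automorphism of $M$) whose age (the class of finite structures embeddable in $M$) is a Ramsey class of rigid structures (i.e. with trivial automorphism group). A class $\mathcal{C}$ of finite structures is a Ramsey class if it is closed under isomorphisms and substructures and for all $k\in\mathbb{N}$ and $A\subseteq B\in\mathcal{C}$ there is $B\subseteq C\in\mathcal{C}$ such that for every $k$-colouring of the set $\binom{C}{A}$ of substructures of $C$ isomorphic to $A$ there is a copy $B'$ of $B$ in $C$ such that the colouring is constant on $\binom{B'}{A}$. *)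

theory Defs
  imports Complex_Main "HOL-Library.Poly_Mapping" "HOL-Library.Countable_Set"
    "HOL-Algebra.Group_Action"
begin

section \<open>First-order structures\<close>

record ('f, 'p) lang =
  fsyms :: "'f set"
  farity :: "'f \<Rightarrow> nat"
  psyms :: "'p set"
  parity :: "'p \<Rightarrow> nat"

text \<open>The interpretations are total functions on lists; only their values at symbols of the
  language and tuples from the universe of the right length matter. Constants are function
  symbols of arity 0. Universes may be empty.\<close>

record ('m, 'f, 'p) fo_struct =
  univ :: "'m set"
  fn :: "'f \<Rightarrow> 'm list \<Rightarrow> 'm"
  rl :: "'p \<Rightarrow> 'm list \<Rightarrow> bool"

definition tuples :: "'m set \<Rightarrow> nat \<Rightarrow> 'm list set" where
  "tuples X n = {xs. set xs \<subseteq> X \<and> length xs = n}"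

definition fn_closed :: "('f, 'p) lang \<Rightarrow> ('m, 'f, 'p) fo_struct \<Rightarrow> 'm set \<Rightarrow> bool" where
  "fn_closed L A X \<longleftrightarrow> X \<subseteq> univ A \<and>
     (\<forall>f\<in>fsyms L. \<forall>xs\<in>tuples X (farity L f). fn A f xs \<in> X)"

definition is_struct :: "('f, 'p) lang \<Rightarrow> ('m, 'f, 'p) fo_struct \<Rightarrow> bool" where
  "is_struct L A \<longleftrightarrow> fn_closed L A (univ A)"

text \<open>For \<open>fn_closed L A X\<close>, this is the substructure of \<open>A\<close> with universe \<open>X\<close>.\<close>

definition induced :: "('m, 'f, 'p) fo_struct \<Rightarrow> 'm set \<Rightarrow> ('m, 'f, 'p) fo_struct" where
  "induced A X = A\<lparr>univ := X\<rparr>"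

definition substr ::
  "('f, 'p) lang \<Rightarrow> ('m, 'f, 'p) fo_struct \<Rightarrow> ('m, 'f, 'p) fo_struct \<Rightarrow> bool" where
  "substr L A B \<longleftrightarrow> is_struct L A \<and> is_struct L B \<and> univ A \<subseteq> univ B \<and>
     (\<forall>f\<in>fsyms L. \<forall>xs\<in>tuples (univ A) (farity L f). fn A f xs = fn B f xs) \<and>
     (\<forall>p\<in>psyms L. \<forall>xs\<in>tuples (univ A) (parity L p). rl A p xs \<longleftrightarrow> rl B p xs)"

definition is_iso ::
  "('f, 'p) lang \<Rightarrow> ('m, 'f, 'p) fo_struct \<Rightarrow> ('n, 'f, 'p) fo_struct \<Rightarrow> ('m \<Rightarrow> 'n) \<Rightarrow> bool" where
  "is_iso L A B h \<longleftrightarrow> bij_betw h (univ A) (univ B) \<and>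
     (\<forall>f\<in>fsyms L. \<forall>xs\<in>tuples (univ A) (farity L f). h (fn A f xs) = fn B f (map h xs)) \<and>
     (\<forall>p\<in>psyms L. \<forall>xs\<in>tuples (univ A) (parity L p). rl A p xs \<longleftrightarrow> rl B p (map h xs))"

definition isomorphic ::
  "('f, 'p) lang \<Rightarrow> ('m, 'f, 'p) fo_struct \<Rightarrow> ('n, 'f, 'p) fo_struct \<Rightarrow> bool" where
  "isomorphic L A B \<longleftrightarrow> (\<exists>h. is_iso L A B h)"

definition Aut :: "('f, 'p) lang \<Rightarrow> ('m, 'f, 'p) fo_struct \<Rightarrow> ('m \<Rightarrow> 'm) monoid" where
  "Aut L A = (BijGroup (univ A))\<lparr>carrier := {g \<in> Bij (univ A). is_iso L A A g}\<rparr>"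

definition pointwise_stabilizer ::
  "('g, 'z) monoid_scheme \<Rightarrow> ('g \<Rightarrow> 'a \<Rightarrow> 'a) \<Rightarrow> 'a set \<Rightarrow> ('g, 'z) monoid_scheme" where
  "pointwise_stabilizer G act A = G\<lparr>carrier := {g \<in> carrier G. \<forall>a\<in>A. act g a = a}\<rparr>"

text \<open>The definition of \<open>\<omega>\<close>-categoricity in terms of the automorphism group (the form given by
  the Ryll-Nardzewski theorem).\<close>

definition omega_categorical :: "('f, 'p) lang \<Rightarrow> ('m, 'f, 'p) fo_struct \<Rightarrow> bool" where
  "omega_categorical L M \<longleftrightarrow> is_struct L M \<and> countable (univ M) \<and> infinite (univ M) \<and>
     (\<forall>n. finite (orbits (Aut L M) (tuples (univ M) n) map))"


section \<open>Ramsey structures\<close>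

definition rigid :: "('f, 'p) lang \<Rightarrow> ('m, 'f, 'p) fo_struct \<Rightarrow> bool" where
  "rigid L A \<longleftrightarrow> carrier (Aut L A) = {\<one>\<^bsub>Aut L A\<^esub>}"

text \<open>The universe of a finite structure is a finite subset of the type \<open>'m\<close>. For infinite \<open>'m\<close>
  every finite structure has an isomorphic copy of this form, and every finite subset
  of \<open>'m\<close> can be enlarged inside \<open>'m\<close>.\<close>

definition age ::
  "('f, 'p) lang \<Rightarrow> ('m, 'f, 'p) fo_struct \<Rightarrow> ('m, 'f, 'p) fo_struct set" where
  "age L M = {A. is_struct L A \<and> finite (univ A) \<and>
     (\<exists>Y. fn_closed L M Y \<and> isomorphic L A (induced M Y))}"

definition copies ::
  "('f, 'p) lang \<Rightarrow> ('m, 'f, 'p) fo_struct \<Rightarrow> ('m, 'f, 'p) fo_struct \<Rightarrow> ('m, 'f, 'p) fo_struct set"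
  where
  "copies L C A = {induced C X |X. fn_closed L C X \<and> isomorphic L A (induced C X)}"

definition ramsey_class :: "('f, 'p) lang \<Rightarrow> ('m, 'f, 'p) fo_struct set \<Rightarrow> bool" where
  "ramsey_class L K \<longleftrightarrow>
     (\<forall>A\<in>K. is_struct L A \<and> finite (univ A)) \<and>
     (\<forall>A\<in>K. \<forall>B. is_struct L B \<and> isomorphic L A B \<longrightarrow> B \<in> K) \<and>
     (\<forall>B\<in>K. \<forall>A. substr L A B \<longrightarrow> A \<in> K) \<and>
     (\<forall>k::nat. \<forall>B\<in>K. \<forall>A. substr L A B \<longrightarrow>
        (\<exists>C\<in>K. substr L B C \<and>
           (\<forall>c \<in> copies L C A \<rightarrow> {..<k}.
              \<exists>B'\<in>copies L C B. \<exists>i. \<forall>A'\<in>copies L B' A. c A' = i)))"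

definition locally_finite :: "('f, 'p) lang \<Rightarrow> ('m, 'f, 'p) fo_struct \<Rightarrow> bool" where
  "locally_finite L M \<longleftrightarrow> (\<forall>X. finite X \<and> X \<subseteq> univ M \<longrightarrow> finite (fn_closed L M hull X))"

definition ultrahomogeneous :: "('f, 'p) lang \<Rightarrow> ('m, 'f, 'p) fo_struct \<Rightarrow> bool" where
  "ultrahomogeneous L M \<longleftrightarrow>
     (\<forall>X Y h. finite X \<and> finite Y \<and> fn_closed L M X \<and> fn_closed L M Y \<and>
        is_iso L (induced M X) (induced M Y) h \<longrightarrow>
        (\<exists>g\<in>carrier (Aut L M). \<forall>x\<in>X. g x = h x))"

definition ramsey_structure :: "('f, 'p) lang \<Rightarrow> ('m, 'f, 'p) fo_struct \<Rightarrow> bool" where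
  "ramsey_structure L M \<longleftrightarrow> is_struct L M \<and> countable (univ M) \<and>
     locally_finite L M \<and> ultrahomogeneous L M \<and>
     ramsey_class L (age L M) \<and> (\<forall>A\<in>age L M. rigid L A)"


section \<open>Definability and imaginaries\<close>

datatype 'f tm = Var nat | App 'f "'f tm list"

datatype ('f, 'p) fm =
    Eq "'f tm" "'f tm"
  | Rel 'p "'f tm list"
  | Neg "('f, 'p) fm"
  | Conj "('f, 'p) fm" "('f, 'p) fm"
  | Exi nat "('f, 'p) fm"

fun wf_tm :: "('f, 'p) lang \<Rightarrow> 'f tm \<Rightarrow> bool" where
  "wf_tm L (Var i) \<longleftrightarrow> True"
| "wf_tm L (App f ts) \<longleftrightarrow> f \<in> fsyms L \<and> length ts = farity L f \<and> (\<forall>t\<in>set ts. wf_tm L t)"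

fun wf_fm :: "('f, 'p) lang \<Rightarrow> ('f, 'p) fm \<Rightarrow> bool" where
  "wf_fm L (Eq s t) \<longleftrightarrow> wf_tm L s \<and> wf_tm L t"
| "wf_fm L (Rel p ts) \<longleftrightarrow> p \<in> psyms L \<and> length ts = parity L p \<and> (\<forall>t\<in>set ts. wf_tm L t)"
| "wf_fm L (Neg \<phi>) \<longleftrightarrow> wf_fm L \<phi>"
| "wf_fm L (Conj \<phi> \<psi>) \<longleftrightarrow> wf_fm L \<phi> \<and> wf_fm L \<psi>"
| "wf_fm L (Exi i \<phi>) \<longleftrightarrow> wf_fm L \<phi>"

fun fv_tm :: "'f tm \<Rightarrow> nat set" where
  "fv_tm (Var i) = {i}"
| "fv_tm (App f ts) = (\<Union>t\<in>set ts. fv_tm t)"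

fun fv :: "('f, 'p) fm \<Rightarrow> nat set" where
  "fv (Eq s t) = fv_tm s \<union> fv_tm t"
| "fv (Rel p ts) = (\<Union>t\<in>set ts. fv_tm t)"
| "fv (Neg \<phi>) = fv \<phi>"
| "fv (Conj \<phi> \<psi>) = fv \<phi> \<union> fv \<psi>"
| "fv (Exi i \<phi>) = fv \<phi> - {i}"

fun val :: "('m, 'f, 'p) fo_struct \<Rightarrow> (nat \<Rightarrow> 'm) \<Rightarrow> 'f tm \<Rightarrow> 'm" where
  "val M e (Var i) = e i"
| "val M e (App f ts) = fn M f (map (val M e) ts)"

fun sat :: "('m, 'f, 'p) fo_struct \<Rightarrow> (nat \<Rightarrow> 'm) \<Rightarrow> ('f, 'p) fm \<Rightarrow> bool" where
  "sat M e (Eq s t) \<longleftrightarrow> val M e s = val M e t"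
| "sat M e (Rel p ts) \<longleftrightarrow> rl M p (map (val M e) ts)"
| "sat M e (Neg \<phi>) \<longleftrightarrow> \<not> sat M e \<phi>"
| "sat M e (Conj \<phi> \<psi>) \<longleftrightarrow> sat M e \<phi> \<and> sat M e \<psi>"
| "sat M e (Exi i \<phi>) \<longleftrightarrow> (\<exists>a\<in>univ M. sat M (e(i := a)) \<phi>)"

text \<open>Definability without parameters. As the free variables of \<open>\<phi>\<close> are below \<open>n\<close>, the values
  \<open>xs ! i\<close> for \<open>i \<ge> n\<close> are irrelevant.\<close>

definition definable ::
  "('f, 'p) lang \<Rightarrow> ('m, 'f, 'p) fo_struct \<Rightarrow> nat \<Rightarrow> 'm list set \<Rightarrow> bool" where
  "definable L M n D \<longleftrightarrow>
     (\<exists>\<phi>. wf_fm L \<phi> \<and> fv \<phi> \<subseteq> {..<n} \<and> D = {xs \<in> tuples (univ M) n. sat M (\<lambda>i. xs ! i) \<phi>})"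

text \<open>A binary relation on \<open>M\<^sup>n\<close> is definable as a subset of \<open>M\<^sup>2\<^sup>n\<close>.\<close>

definition imaginaries :: "('f, 'p) lang \<Rightarrow> ('m, 'f, 'p) fo_struct \<Rightarrow> 'm list set set" where
  "imaginaries L M = {w. \<exists>n D E. definable L M n D \<and> equiv D E \<and>
     definable L M (2 * n) {a @ b |a b. (a, b) \<in> E} \<and> w \<in> D // E}"

definition act_eq :: "('m \<Rightarrow> 'm) \<Rightarrow> 'm list set \<Rightarrow> 'm list set" where
  "act_eq g w = map g ` w"

definition is_sort :: "('f, 'p) lang \<Rightarrow> ('m, 'f, 'p) fo_struct \<Rightarrow> 'm list set set \<Rightarrow> bool" where
  "is_sort L M W \<longleftrightarrow> (\<exists>Os. finite Os \<and> Os \<subseteq> orbits (Aut L M) (imaginaries L M) act_eq \<and> W = \<Union>Os)"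


section \<open>Permutation modules\<close>

text \<open>The sort \<open>{comm_ring, comm_monoid_mult}\<close> consists of the commutative rings with 1;
  the class \<open>comm_ring_1\<close> would in addition exclude the zero ring.\<close>

definition free_module :: "'w set \<Rightarrow> ('w \<Rightarrow>\<^sub>0 'r::zero) set" where
  "free_module W = {x. Poly_Mapping.keys x \<subseteq> W}"

definition lin_act :: "('g \<Rightarrow> 'w \<Rightarrow> 'w) \<Rightarrow> 'g \<Rightarrow> ('w \<Rightarrow>\<^sub>0 'r) \<Rightarrow> ('w \<Rightarrow>\<^sub>0 'r::comm_ring)" where
  "lin_act act g x = (\<Sum>w\<in>Poly_Mapping.keys x. Poly_Mapping.single (act g w) (Poly_Mapping.lookup x w))"

definition smul :: "'r \<Rightarrow> ('w \<Rightarrow>\<^sub>0 'r) \<Rightarrow> ('w \<Rightarrow>\<^sub>0 'r::comm_ring)" where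
  "smul r x = Poly_Mapping.map (\<lambda>c. r * c) x"

text \<open>The elements of the group ring \<open>RG\<close> are the \<open>a\<close> in \<open>free_module (carrier G)\<close>.\<close>

definition gr_act :: "('g \<Rightarrow> 'w \<Rightarrow> 'w) \<Rightarrow> ('g \<Rightarrow>\<^sub>0 'r) \<Rightarrow> ('w \<Rightarrow>\<^sub>0 'r) \<Rightarrow> ('w \<Rightarrow>\<^sub>0 'r::comm_ring)" where
  "gr_act act a x = (\<Sum>g\<in>Poly_Mapping.keys a. smul (Poly_Mapping.lookup a g) (lin_act act g x))"

definition RG_submodule ::
  "('g, 'z) monoid_scheme \<Rightarrow> ('g \<Rightarrow> 'w \<Rightarrow> 'w) \<Rightarrow> 'w set \<Rightarrow>
   ('w \<Rightarrow>\<^sub>0 'r::{comm_ring, comm_monoid_mult}) set \<Rightarrow> bool" where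
  "RG_submodule G act W U \<longleftrightarrow> U \<subseteq> free_module W \<and> 0 \<in> U \<and> (\<forall>x\<in>U. \<forall>y\<in>U. x + y \<in> U) \<and>
     (\<forall>a\<in>free_module (carrier G). \<forall>x\<in>U. gr_act act a x \<in> U)"

text \<open>An element of \<open>R\<^sup>\<ell>\<close> is a function on \<open>nat\<close> that vanishes outside \<open>{..<\<ell>}\<close>.\<close>

definition R_submodule :: "nat \<Rightarrow> (nat \<Rightarrow> 'r::{comm_ring, comm_monoid_mult}) set \<Rightarrow> bool" where
  "R_submodule l U \<longleftrightarrow> U \<subseteq> {y. \<forall>i\<ge>l. y i = 0} \<and> (\<lambda>i. 0) \<in> U \<and>
     (\<forall>y\<in>U. \<forall>z\<in>U. (\<lambda>i. y i + z i) \<in> U) \<and> (\<forall>r. \<forall>y\<in>U. (\<lambda>i. r * y i) \<in> U)"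

text \<open>The sum is restricted to the support because the sets in \<open>Ws\<close> may be infinite.\<close>

definition Omega :: "'w set list \<Rightarrow> ('w \<Rightarrow>\<^sub>0 'r::comm_ring) \<Rightarrow> nat \<Rightarrow> 'r" where
  "Omega Ws y = (\<lambda>i. if i < length Ws then \<Sum>w\<in>Poly_Mapping.keys y \<inter> Ws ! i. Poly_Mapping.lookup y w else 0)"

definition representatives :: "'a list \<Rightarrow> 'a set set \<Rightarrow> bool" where
  "representatives us Os \<longleftrightarrow> set us \<subseteq> \<Union>Os \<and> (\<forall>orb\<in>Os. \<exists>!i. i < length us \<and> us ! i \<in> orb)"

end

theory Submission
  imports Defs
begin

text \<open>Let \<open>U\<close> be an \<open>RG\<close>-submodule and \<open>y \<in> U\<close> with \<open>\<Omega>\<^sub>S(x) = \<Omega>\<^sub>S(y)\<close>; the point is to show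
  \<open>x \<in> U\<close>. Otherwise some character of \<open>RW\<close> with values in \<open>\<real> / \<int>\<close> vanishes on \<open>U\<close> and sends \<open>x\<close> to
  distance at least \<open>1 / 4\<close> from \<open>0\<close>. As \<open>\<Omega>\<^sub>S(y - x) = 0\<close>, the vector \<open>y - x\<close> is a finite sum of terms
  \<open>c w - c w'\<close> with \<open>w, w'\<close> in the same orbit of \<open>H = G\<^sub>(\<^sub>S\<^sub>)\<close>. Colour \<open>h \<in> H\<close> by the character values of
  the elements \<open>c (h w)\<close>, rounded to finitely many arcs of the circle. The Ramsey property, transferred
  from \<open>G\<close> to its open subgroup \<open>H\<close>, yields an \<open>h\<close> for which all differences \<open>c (h w) - c (h w')\<close> have
  almost trivial character values, hence so has \<open>h y - x\<close>; but \<open>h y \<in> U\<close>, a contradiction.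
  Rounding makes the number of colours finite although \<open>R\<close> may be infinite.\<close>

section \<open>Automorphisms\<close>

text \<open>Colouring \<open>h\<close> by the classes of the elements \<open>c (h w)\<close> in the
  quotient of \<open>RW\<close> by \<open>U\<close> would give exact equalities at once, but that
  quotient may be infinite, while the Ramsey property handles finitely many colours. A character
  into a compact group trades exactness for approximation. Nothing is lost: the separation distance
  is an absolute constant, and the number of terms is the size of the support of
  \<open>y - x\<close>, which is known before the arcs are chosen. So the arcs can be made short
  enough for all errors together to stay below that distance. The character is merely additive;
  scalars are absorbed by colouring each \<open>w\<close> together with its own coefficient. The
  stabiliser of the support is the right group because its elements fix \<open>x\<close>, so that
  \<open>h (y - x) = h y - x\<close>, and because its orbits on \<open>W\<close> are those over
  which \<open>Omega\<close> sums. In the converse direction the obstacle is that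
  \<open>Omega\<close> is linear and invariant under \<open>H\<close> but not compatible with
  \<open>G\<close>. Hence the \<open>RG\<close>-span is first rewritten as the \<open>R\<close>-span
  of whole \<open>G\<close>-orbits, whose members differ from the chosen representatives by elements
  of \<open>H\<close>.\<close>

lemma Aut_carrier:
  "g \<in> carrier (Aut L M) \<longleftrightarrow> g \<in> extensional (univ M) \<and> is_iso L M M g"
  by (auto simp: Aut_def Bij_def is_iso_def)

lemma Aut_bij: "g \<in> carrier (Aut L M) \<Longrightarrow> bij_betw g (univ M) (univ M)"
  by (simp add: Aut_carrier is_iso_def)

lemma Aut_in_univ: "g \<in> carrier (Aut L M) \<Longrightarrow> a \<in> univ M \<Longrightarrow> g a \<in> univ M"
  by (meson Aut_bij bij_betwE)

lemma Aut_mult: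
  "g \<in> carrier (Aut L M) \<Longrightarrow> h \<in> carrier (Aut L M) \<Longrightarrow>
    g \<otimes>\<^bsub>Aut L M\<^esub> h = compose (univ M) g h"
  by (simp add: Aut_def BijGroup_def)

text \<open>Products are formed with \<open>compose (univ M)\<close>, which is
  \<open>undefined\<close> outside the universe. This is the source of the side condition here and
  of the restriction to imaginaries in \<open>act_eq_mult\<close>.\<close>

lemma Aut_mult_apply:
  "g \<in> carrier (Aut L M) \<Longrightarrow> h \<in> carrier (Aut L M) \<Longrightarrow> a \<in> univ M \<Longrightarrow>
    (g \<otimes>\<^bsub>Aut L M\<^esub> h) a = g (h a)"
  by (simp add: Aut_mult compose_def)

lemma Aut_one_apply: "a \<in> univ M \<Longrightarrow> \<one>\<^bsub>Aut L M\<^esub> a = a"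
  by (simp add: Aut_def BijGroup_def)

lemma is_iso_id: "(\<And>a. a \<in> univ A \<Longrightarrow> h a = a) \<Longrightarrow> is_struct L A \<Longrightarrow> is_iso L A A h"
proof -
  assume h: "\<And>a. a \<in> univ A \<Longrightarrow> h a = a" and A: "is_struct L A"
  have 1: "map h xs = xs" if "xs \<in> tuples (univ A) n" for xs n
    using that h by (auto simp: tuples_def intro: map_idI)
  have "bij_betw h (univ A) (univ A)"
    using h by (simp cong: bij_betw_cong add: bij_betw_def inj_on_def)
  then show ?thesis
    using A h by (auto simp: is_iso_def 1 is_struct_def fn_closed_def)
qed

lemma is_iso_fn:
  "is_iso L A B f \<Longrightarrow> s \<in> fsyms L \<Longrightarrow> xs \<in> tuples (univ A) (farity L s) \<Longrightarrow>
    f (fn A s xs) = fn B s (map f xs)"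
  by (simp add: is_iso_def)

lemma is_iso_rl:
  "is_iso L A B f \<Longrightarrow> s \<in> psyms L \<Longrightarrow> xs \<in> tuples (univ A) (parity L s) \<Longrightarrow>
    rl A s xs \<longleftrightarrow> rl B s (map f xs)"
  by (simp add: is_iso_def)

lemma is_iso_comp:
  assumes f: "is_iso L A B f" and g: "is_iso L B C g" and A: "is_struct L A"
    and h: "\<And>a. a \<in> univ A \<Longrightarrow> h a = g (f a)"
  shows "is_iso L A C h"
proof -
  have bf: "f ` univ A = univ B" using f by (simp add: is_iso_def bij_betw_def)
  have bij: "bij_betw h (univ A) (univ C)"
  proof -
    have "bij_betw (g \<circ> f) (univ A) (univ C)"
      using f g by (auto simp: is_iso_def intro: bij_betw_trans)
    then show ?thesis
      using bij_betw_cong[of "univ A" h "g \<circ> f"] h by simp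
  qed
  have m: "map h xs = map g (map f xs)" if "xs \<in> tuples (univ A) n" for xs n
    using that h by (auto simp: tuples_def)
  have t: "map f xs \<in> tuples (univ B) n" if "xs \<in> tuples (univ A) n" for xs n
    using that bf by (auto simp: tuples_def)
  have c: "fn A s xs \<in> univ A" if "s \<in> fsyms L" "xs \<in> tuples (univ A) (farity L s)" for s xs
    using A that by (auto simp: is_struct_def fn_closed_def)
  show ?thesis
    unfolding is_iso_def
  proof (intro conjI ballI)
    fix s xs assume "s \<in> fsyms L" "xs \<in> tuples (univ A) (farity L s)"
    then show "h (fn A s xs) = fn C s (map h xs)"
      using is_iso_fn[OF f] is_iso_fn[OF g] c t m h by (simp del: map_map map_eq_conv)
  next
    fix s xs assume "s \<in> psyms L" "xs \<in> tuples (univ A) (parity L s)"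
    then show "rl A s xs \<longleftrightarrow> rl C s (map h xs)"
      using is_iso_rl[OF f] is_iso_rl[OF g] t m by (simp del: map_map map_eq_conv)
  qed (fact bij)
qed

lemma is_iso_inv:
  assumes f: "is_iso L A B f" and A: "is_struct L A"
    and h: "\<And>a. a \<in> univ A \<Longrightarrow> h (f a) = a"
  shows "is_iso L B A h"
proof -
  have bf: "bij_betw f (univ A) (univ B)" using f by (simp add: is_iso_def)
  have fh: "f (h b) = b \<and> h b \<in> univ A" if b: "b \<in> univ B" for b
  proof -
    obtain a where "a \<in> univ A" "b = f a"
      using b bf unfolding bij_betw_def by blast
    then show ?thesis using h by simp
  qed
  have bij: "bij_betw h (univ B) (univ A)"
    using fh h bij_betw_imp_surj_on[OF bf] by (intro bij_betw_byWitness[where f' = f]) blast+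
  have t: "map h xs \<in> tuples (univ A) n \<and> map f (map h xs) = xs" if "xs \<in> tuples (univ B) n" for xs n
    using that fh by (auto simp: tuples_def intro!: map_idI)
  have c: "fn A s xs \<in> univ A" if "s \<in> fsyms L" "xs \<in> tuples (univ A) (farity L s)" for s xs
    using A that by (auto simp: is_struct_def fn_closed_def)
  show ?thesis
    unfolding is_iso_def
  proof (intro conjI ballI)
    fix s xs assume *: "s \<in> fsyms L" "xs \<in> tuples (univ B) (farity L s)"
    then have "f (fn A s (map h xs)) = fn B s xs"
      using is_iso_fn[OF f *(1)] t[OF *(2)] by simp
    then show "h (fn B s xs) = fn A s (map h xs)"
      using h[OF c[OF *(1)]] t[OF *(2)] by metis
  next
    fix s xs assume *: "s \<in> psyms L" "xs \<in> tuples (univ B) (parity L s)"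
    then show "rl B s xs \<longleftrightarrow> rl A s (map h xs)"
      using is_iso_rl[OF f *(1)] t[OF *(2)] by simp
  qed (fact bij)
qed

lemma group_Aut:
  assumes M: "is_struct L M"
  shows "group (Aut L M)"
proof -
  have "subgroup (carrier (Aut L M)) (BijGroup (univ M))"
  proof (rule group.subgroupI[OF group_BijGroup])
    show "carrier (Aut L M) \<subseteq> carrier (BijGroup (univ M))"
      by (auto simp: Aut_def BijGroup_def)
    have "(\<lambda>x\<in>univ M. x) \<in> carrier (Aut L M)"
      using M by (auto simp: Aut_carrier intro: is_iso_id)
    then show "carrier (Aut L M) \<noteq> {}" by blast
  next
    fix g assume g: "g \<in> carrier (Aut L M)"
    then have gB: "g \<in> Bij (univ M)" by (auto simp: Aut_def)
    have "is_iso L M M (\<lambda>x\<in>univ M. inv_into (univ M) g x)"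
      proof (rule is_iso_inv[OF _ M])
      show "is_iso L M M g" using g by (simp add: Aut_carrier)
      show "(\<lambda>x\<in>univ M. inv_into (univ M) g x) (g a) = a" if "a \<in> univ M" for a
        using that Aut_in_univ[OF g that] bij_betw_inv_into_left[OF Aut_bij[OF g] that] by simp
    qed
    then show "inv\<^bsub>BijGroup (univ M)\<^esub> g \<in> carrier (Aut L M)"
      unfolding inv_BijGroup[OF gB] Aut_carrier by simp
  next
    fix g h assume g: "g \<in> carrier (Aut L M)" and h: "h \<in> carrier (Aut L M)"
    have "is_iso L M M (compose (univ M) g h)"
      by (rule is_iso_comp[of L M M h M g]) (use g h M in \<open>simp_all add: Aut_carrier compose_def\<close>)
    then show "g \<otimes>\<^bsub>BijGroup (univ M)\<^esub> h \<in> carrier (Aut L M)"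
      using g h by (simp add: Aut_def BijGroup_def compose_Bij)
  qed
  then have "group (BijGroup (univ M)\<lparr>carrier := carrier (Aut L M)\<rparr>)"
    by (rule subgroup.subgroup_is_group[OF _ group_BijGroup])
  then show ?thesis by (simp add: Aut_def)
qed

lemma Aut_inv_apply:
  assumes "is_struct L M" "g \<in> carrier (Aut L M)" "a \<in> univ M"
  shows "(inv\<^bsub>Aut L M\<^esub> g) (g a) = a" "g ((inv\<^bsub>Aut L M\<^esub> g) a) = a"
proof -
  interpret group "Aut L M" using assms(1) by (rule group_Aut)
  have "(inv\<^bsub>Aut L M\<^esub> g \<otimes>\<^bsub>Aut L M\<^esub> g) a = (inv\<^bsub>Aut L M\<^esub> g) (g a)"
    by (rule Aut_mult_apply) (use assms(2,3) in simp_all)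
  moreover have "(g \<otimes>\<^bsub>Aut L M\<^esub> inv\<^bsub>Aut L M\<^esub> g) a = g ((inv\<^bsub>Aut L M\<^esub> g) a)"
    by (rule Aut_mult_apply) (use assms(2,3) in simp_all)
  ultimately show "(inv\<^bsub>Aut L M\<^esub> g) (g a) = a" "g ((inv\<^bsub>Aut L M\<^esub> g) a) = a"
    using assms(2,3) by (simp_all add: Aut_one_apply)
qed

section \<open>Imaginaries\<close>

lemma val_Aut:
  assumes M: "is_struct L M" and g: "g \<in> carrier (Aut L M)"
  shows "wf_tm L t \<Longrightarrow> \<forall>i\<in>fv_tm t. e i \<in> univ M \<and> e' i = g (e i) \<Longrightarrow>
    val M e t \<in> univ M \<and> val M e' t = g (val M e t)"
proof (induction t)
  case (App f ts)
  have IH: "\<forall>t\<in>set ts. val M e t \<in> univ M \<and> val M e' t = g (val M e t)"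
    using App by auto
  have tup: "map (val M e) ts \<in> tuples (univ M) (farity L f)"
    using App.prems IH by (auto simp: tuples_def)
  have "map (val M e') ts = map g (map (val M e) ts)"
    using IH by auto
  then show ?case
    using M g tup App.prems(1)
    by (auto simp: is_struct_def fn_closed_def Aut_carrier is_iso_def simp del: map_map)
qed auto

lemma sat_Aut:
  assumes M: "is_struct L M" and g: "g \<in> carrier (Aut L M)"
  shows "wf_fm L \<phi> \<Longrightarrow> \<forall>i\<in>fv \<phi>. e i \<in> univ M \<and> e' i = g (e i) \<Longrightarrow>
    sat M e' \<phi> \<longleftrightarrow> sat M e \<phi>"
proof (induction \<phi> arbitrary: e e')
  case (Eq s t)
  have "inj_on g (univ M)" using Aut_bij[OF g] by (simp add: bij_betw_def)
  then show ?case
    using Eq val_Aut[OF M g, of s e e'] val_Aut[OF M g, of t e e']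
    by (auto simp: inj_on_eq_iff)
next
  case (Rel p ts)
  have IH: "\<forall>t\<in>set ts. val M e t \<in> univ M \<and> val M e' t = g (val M e t)"
    using Rel by (auto intro!: val_Aut[OF M g])
  have tup: "map (val M e) ts \<in> tuples (univ M) (parity L p)"
    using Rel.prems IH by (auto simp: tuples_def)
  have "map (val M e') ts = map g (map (val M e) ts)"
    using IH by auto
  then show ?case
    using g tup Rel.prems(1) by (auto simp: Aut_carrier is_iso_def simp del: map_map)
next
  case (Exi i \<phi>)
  have step: "sat M (e'(i := g a)) \<phi> \<longleftrightarrow> sat M (e(i := a)) \<phi>" if "a \<in> univ M" for a
    using Exi.prems that by (intro Exi.IH) auto
  have "univ M = g ` univ M" using Aut_bij[OF g] by (simp add: bij_betw_def)
  then have "(\<exists>b\<in>univ M. sat M (e'(i := b)) \<phi>) \<longleftrightarrow> (\<exists>a\<in>univ M. sat M (e'(i := g a)) \<phi>)"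
    using Aut_in_univ[OF g] by (metis imageE)
  then show ?case using step by simp
next
  case (Conj \<phi> \<psi>)
  have "sat M e' \<phi> \<longleftrightarrow> sat M e \<phi>" "sat M e' \<psi> \<longleftrightarrow> sat M e \<psi>"
    using Conj.prems by (auto intro!: Conj.IH)
  then show ?case by simp
qed auto

lemma definable_Aut:
  assumes M: "is_struct L M" and g: "g \<in> carrier (Aut L M)"
    and D: "definable L M n D" and xs: "xs \<in> D"
  shows "map g xs \<in> D"
proof -
  obtain \<phi> where \<phi>: "wf_fm L \<phi>" "fv \<phi> \<subseteq> {..<n}"
    and D_eq: "D = {xs \<in> tuples (univ M) n. sat M (\<lambda>i. xs ! i) \<phi>}"
    using D unfolding definable_def by blast
  have t: "xs \<in> tuples (univ M) n" using xs D_eq by simp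
  have "\<forall>i\<in>fv \<phi>. xs ! i \<in> univ M \<and> map g xs ! i = g (xs ! i)"
    using \<phi>(2) t by (auto simp: tuples_def subset_iff)
  then have "sat M (\<lambda>i. map g xs ! i) \<phi>"
    using sat_Aut[OF M g \<phi>(1)] xs D_eq by blast
  moreover have "map g xs \<in> tuples (univ M) n"
    using t Aut_in_univ[OF g] by (auto simp: tuples_def)
  ultimately show ?thesis using D_eq by simp
qed

lemma imaginary_tuples:
  assumes "w \<in> imaginaries L M" "a \<in> w"
  shows "set a \<subseteq> univ M"
proof -
  obtain n D E where "definable L M n D" "equiv D E" "w \<in> D // E"
    using assms(1) unfolding imaginaries_def by blast
  then have "a \<in> D" "D \<subseteq> tuples (univ M) n"
    using assms(2) in_quotient_imp_subset by (auto simp: definable_def)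
  then show ?thesis by (auto simp: tuples_def)
qed

text \<open>Automorphisms preserve the definable relation \<open>E\<close>, so they carry the class
  of \<open>a\<close> to the class of its image. From this one formula follow both that the image is
  again imaginary and that it depends only on the values of \<open>g\<close> on the entries of
  \<open>a\<close>.\<close>

lemma act_eq_class:
  assumes M: "is_struct L M" and w: "w \<in> imaginaries L M" and a: "a \<in> w"
  obtains n D E where "definable L M n D" "equiv D E"
    "definable L M (2 * n) {a @ b |a b. (a, b) \<in> E}"
    "\<And>g. g \<in> carrier (Aut L M) \<Longrightarrow> map g a \<in> D \<and> act_eq g w = E `` {map g a}"
proof -
  obtain n D E where D: "definable L M n D" and E: "equiv D E"
    and E2: "definable L M (2 * n) {a @ b |a b. (a, b) \<in> E}" and wDE: "w \<in> D // E"
    using w unfolding imaginaries_def by blast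
  have aD: "a \<in> D" using wDE a E in_quotient_imp_subset by blast
  have w_eq: "w = E `` {a}"
    using wDE a E by (auto elim!: quotientE dest: equiv_class_eq)
  have len: "length b = n \<and> set b \<subseteq> univ M" if "b \<in> D" for b
    using that D by (auto simp: definable_def tuples_def)
  have ED: "b \<in> D \<and> c \<in> D" if "(b, c) \<in> E" for b c
    using that E by (auto simp: equiv_def)
  have inv: "(map g b, map g c) \<in> E" if g: "g \<in> carrier (Aut L M)" and bc: "(b, c) \<in> E" for g b c
  proof -
    have "map g (b @ c) \<in> {a @ b |a b. (a, b) \<in> E}"
      by (rule definable_Aut[OF M g E2]) (use bc in blast)
    then obtain b' c' where bc': "map g b @ map g c = b' @ c'" "(b', c') \<in> E" by auto
    \<comment> \<open>All tuples in \<open>D\<close> have length \<open>n\<close>, so a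
      concatenation of two of them splits in only one way.\<close>
    have "length (map g b) = length b'" using len ED bc bc'(2) by simp
    then show ?thesis using bc' by simp
  qed
  have "act_eq g w = E `` {map g a}" if g: "g \<in> carrier (Aut L M)" for g
  proof
    show "act_eq g w \<subseteq> E `` {map g a}"
      using inv[OF g] by (auto simp: act_eq_def w_eq)
  next
    interpret group "Aut L M" using M by (rule group_Aut)
    let ?i = "inv\<^bsub>Aut L M\<^esub> g"
    show "E `` {map g a} \<subseteq> act_eq g w"
    proof
      fix c assume "c \<in> E `` {map g a}"
      then have c: "(map g a, c) \<in> E" by simp
      have "(map ?i (map g a), map ?i c) \<in> E" using c g by (intro inv) auto
      moreover have "map ?i (map g a) = a"
        using len[OF aD] Aut_inv_apply[OF M g] by (auto intro!: map_idI)
      moreover have "map g (map ?i c) = c"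
        using len[of c] ED[OF c] Aut_inv_apply[OF M g] by (auto intro!: map_idI)
      ultimately show "c \<in> act_eq g w"
        unfolding act_eq_def w_eq by (metis Image_singleton_iff image_eqI)
    qed
  qed
  then show thesis
    using that D E E2 definable_Aut[OF M _ D aD] by blast
qed

lemma imaginary_nonempty: "w \<in> imaginaries L M \<Longrightarrow> w \<noteq> {}"
  unfolding imaginaries_def by (auto dest: in_quotient_imp_non_empty)

lemma act_eq_imaginary:
  assumes M: "is_struct L M" and w: "w \<in> imaginaries L M" and g: "g \<in> carrier (Aut L M)"
  shows "act_eq g w \<in> imaginaries L M"
proof -
  obtain a where a: "a \<in> w" using imaginary_nonempty[OF w] by blast
  obtain n D E where D: "definable L M n D" and E: "equiv D E"
    and E2: "definable L M (2 * n) {a @ b |a b. (a, b) \<in> E}"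
    and *: "\<And>g. g \<in> carrier (Aut L M) \<Longrightarrow> map g a \<in> D \<and> act_eq g w = E `` {map g a}"
    by (rule act_eq_class[OF M w a]) (rule that)
  have "act_eq g w \<in> D // E"
    using *[OF g] by (metis quotientI)
  then show ?thesis
    unfolding imaginaries_def using D E E2 by blast
qed

text \<open>Continuity of the action: the entries of any tuple in the class form a finite support.
  The condition compares two automorphisms, the form needed to see that a colouring depends on
  finitely many values.\<close>

lemma act_eq_support:
  assumes M: "is_struct L M" and w: "w \<in> imaginaries L M"
  obtains A where "finite A" "A \<subseteq> univ M"
    "\<And>g h. g \<in> carrier (Aut L M) \<Longrightarrow> h \<in> carrier (Aut L M) \<Longrightarrow> \<forall>a\<in>A. g a = h a \<Longrightarrow>
      act_eq g w = act_eq h w"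
proof -
  obtain a where a: "a \<in> w" using imaginary_nonempty[OF w] by blast
  obtain D E where
    "\<And>g. g \<in> carrier (Aut L M) \<Longrightarrow> map g a \<in> D \<and> act_eq g w = E `` {map g a}"
    by (rule act_eq_class[OF M w a]) (rule that)
  moreover have "map g a = map h a" if "\<forall>b\<in>set a. g b = h b" for g h
    using that by simp
  ultimately have "\<And>g h. g \<in> carrier (Aut L M) \<Longrightarrow> h \<in> carrier (Aut L M) \<Longrightarrow>
      \<forall>b\<in>set a. g b = h b \<Longrightarrow> act_eq g w = act_eq h w"
    by metis
  then show thesis
    using that[of "set a"] imaginary_tuples[OF w a] by blast
qed

lemma act_eq_mult:
  assumes w: "w \<in> imaginaries L M"
    and g: "g \<in> carrier (Aut L M)" and h: "h \<in> carrier (Aut L M)"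
  shows "act_eq (g \<otimes>\<^bsub>Aut L M\<^esub> h) w = act_eq g (act_eq h w)"
proof -
  have "map (g \<otimes>\<^bsub>Aut L M\<^esub> h) a = map g (map h a)" if "a \<in> w" for a
    using imaginary_tuples[OF w that] Aut_mult_apply[OF g h] by auto
  then show ?thesis
    by (simp add: act_eq_def image_image cong: image_cong del: map_map map_eq_conv)
qed

lemma act_eq_one:
  assumes w: "w \<in> imaginaries L M"
  shows "act_eq \<one>\<^bsub>Aut L M\<^esub> w = w"
proof -
  have "map \<one>\<^bsub>Aut L M\<^esub> a = a" if "a \<in> w" for a
    using imaginary_tuples[OF w that] Aut_one_apply by (metis map_idI subsetD)
  then show ?thesis by (simp add: act_eq_def)
qed

section \<open>The Ramsey property for automorphism groups\<close>

lemma univ_induced [simp]: "univ (induced A X) = X"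
  and fn_induced [simp]: "fn (induced A X) = fn A"
  and rl_induced [simp]: "rl (induced A X) = rl A"
  and induced_induced [simp]: "induced (induced A X) Y = induced A Y"
  by (simp_all add: induced_def)

lemma fn_closed_induced:
  "X \<subseteq> univ M \<Longrightarrow> fn_closed L (induced M X) Y \<longleftrightarrow> fn_closed L M Y \<and> Y \<subseteq> X"
  by (auto simp: fn_closed_def)

lemma is_struct_induced: "fn_closed L M X \<Longrightarrow> is_struct L (induced M X)"
  by (simp add: is_struct_def fn_closed_def)

lemma substr_induced:
  "fn_closed L M X \<Longrightarrow> fn_closed L M Y \<Longrightarrow> X \<subseteq> Y \<Longrightarrow> substr L (induced M X) (induced M Y)"
  by (simp add: substr_def is_struct_induced)

lemma is_iso_induced:
  assumes f: "is_iso L A B f" and X: "fn_closed L A X"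
  shows "fn_closed L B (f ` X)" "is_iso L (induced A X) (induced B (f ` X)) f"
proof -
  have XA: "X \<subseteq> univ A" using X by (simp add: fn_closed_def)
  have bij: "bij_betw f (univ A) (univ B)" using f by (simp add: is_iso_def)
  have tA: "xs \<in> tuples (univ A) n" if "xs \<in> tuples X n" for xs n
    using that XA by (auto simp: tuples_def)
  have fnX: "fn A s xs \<in> X" if "s \<in> fsyms L" "xs \<in> tuples X (farity L s)" for s xs
    using X that by (simp add: fn_closed_def)
  have lift: "\<exists>xs\<in>tuples X n. ys = map f xs" if "ys \<in> tuples (f ` X) n" for ys n
  proof -
    have "ys \<in> lists (f ` X)" "length ys = n" using that by (auto simp: tuples_def)
    then obtain xs where "xs \<in> lists X" "ys = map f xs" by (auto simp: lists_image)
    then show ?thesis using \<open>length ys = n\<close> by (auto simp: tuples_def)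
  qed
  show "fn_closed L B (f ` X)"
    unfolding fn_closed_def
  proof (intro conjI ballI)
    show "f ` X \<subseteq> univ B" using bij XA by (auto simp: bij_betw_def)
  next
    fix s ys assume s: "s \<in> fsyms L" and "ys \<in> tuples (f ` X) (farity L s)"
    then obtain xs where xs: "xs \<in> tuples X (farity L s)" "ys = map f xs"
      using lift by blast
    show "fn B s ys \<in> f ` X"
      using is_iso_fn[OF f s tA[OF xs(1)]] fnX[OF s xs(1)] xs(2) by (metis imageI)
  qed
  have "bij_betw f X (f ` X)"
    using bij XA by (meson bij_betw_def inj_on_subset)
  then show "is_iso L (induced A X) (induced B (f ` X)) f"
    unfolding is_iso_def using is_iso_fn[OF f] is_iso_rl[OF f] tA by simp
qed

lemma Aut_induced:
  assumes "g \<in> carrier (Aut L M)" "fn_closed L M X"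
  shows "fn_closed L M (g ` X)" "is_iso L (induced M X) (induced M (g ` X)) g"
  using is_iso_induced[of L M M g X] assms by (auto simp: Aut_carrier)

lemma finite_closed_superset:
  assumes M: "is_struct L M" and lf: "locally_finite L M" and X: "finite X" "X \<subseteq> univ M"
  obtains Y where "finite Y" "fn_closed L M Y" "X \<subseteq> Y"
proof
  show "finite (fn_closed L M hull X)"
    using lf X by (simp add: locally_finite_def)
  show "X \<subseteq> fn_closed L M hull X" by (rule hull_subset)
  \<comment> \<open>The universe is itself a closed superset of \<open>X\<close>, so the
    intersection defining the hull is over a nonempty family.\<close>
  have "fn_closed L M hull X \<subseteq> univ M"
    using M X by (intro hull_minimal) (auto simp: is_struct_def)
  moreover have "fn M s xs \<in> fn_closed L M hull X"
    if s: "s \<in> fsyms L" and xs: "xs \<in> tuples (fn_closed L M hull X) (farity L s)" for s xs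
    unfolding hull_def
  proof (intro InterI, clarify)
    fix t assume t: "fn_closed L M t" "X \<subseteq> t"
    then have "fn_closed L M hull X \<subseteq> t" by (intro hull_minimal)
    then have "xs \<in> tuples t (farity L s)" using xs by (auto simp: tuples_def)
    then show "fn M s xs \<in> t" using t(1) s by (simp add: fn_closed_def)
  qed
  ultimately show "fn_closed L M (fn_closed L M hull X)"
    by (simp add: fn_closed_def)
qed

text \<open>The inverse of \<open>h\<close> followed after \<open>g\<close> restricts to an
  automorphism of the finite substructure on \<open>X\<close>, which rigidity forces to be the
  identity. Thus a copy of \<open>X\<close> determines its embedding, and colouring copies amounts
  to colouring embeddings.\<close>

lemma rigid_Aut_eq:
  assumes M: "is_struct L M" and X: "fn_closed L M X" and rig: "rigid L (induced M X)"
    and g: "g \<in> carrier (Aut L M)" and h: "h \<in> carrier (Aut L M)"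
    and eq: "g ` X = h ` X" and a: "a \<in> X"
  shows "g a = h a"
proof -
  interpret group "Aut L M" using M by (rule group_Aut)
  define k where "k = inv\<^bsub>Aut L M\<^esub> h \<otimes>\<^bsub>Aut L M\<^esub> g"
  have k: "k \<in> carrier (Aut L M)" using g h by (simp add: k_def)
  have XM: "X \<subseteq> univ M" using X by (simp add: fn_closed_def)
  have ka: "k b = (inv\<^bsub>Aut L M\<^esub> h) (g b)" if "b \<in> X" for b
    unfolding k_def by (rule Aut_mult_apply) (use g h that XM in auto)
  have "k ` X = (inv\<^bsub>Aut L M\<^esub> h) ` (g ` X)"
    using ka by (auto simp: image_image)
  also have "\<dots> = (\<lambda>b. b) ` X"
    unfolding eq image_image using XM Aut_inv_apply(1)[OF M h] by (intro image_cong) auto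
  finally have kX: "k ` X = X" by simp
  have st: "is_struct L (induced M X)" using X by (rule is_struct_induced)
  have "is_iso L (induced M X) (induced M X) k"
    using Aut_induced(2)[OF k X] kX by simp
  \<comment> \<open>Members of \<open>Aut\<close> are extensional, so \<open>k\<close> has to be cut
    down to \<open>X\<close> before rigidity applies to it.\<close>
  then have "is_iso L (induced M X) (induced M X) (restrict k X)"
    by (rule is_iso_comp[OF _ is_iso_id[of "induced M X" "\<lambda>b. b"] st]) (use st in auto)
  then have "restrict k X \<in> carrier (Aut L (induced M X))"
    by (simp add: Aut_carrier)
  then have "restrict k X = \<one>\<^bsub>Aut L (induced M X)\<^esub>"
    using rig by (simp add: rigid_def)
  then have "restrict k X a = a"
    using a Aut_one_apply[of a "induced M X" L] by simp
  then have "(inv\<^bsub>Aut L M\<^esub> h) (g a) = a" using a ka by simp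
  then show ?thesis
    using Aut_inv_apply(2)[OF M h, of "g a"] Aut_in_univ[OF g] a XM by auto
qed

text \<open>The group form of the Ramsey property, as in the Kechris-Pestov-Todorcevic
  correspondence. Take a finite closed \<open>X\<close> containing \<open>A\<close> and a finite
  closed \<open>Y\<close> containing all translates of \<open>X\<close> by \<open>K\<close>. A
  colouring that depends on values on \<open>A\<close> becomes a colouring of copies of
  \<open>X\<close>. A monochromatic copy of \<open>Y\<close> is the image of \<open>Y\<close> under
  some automorphism \<open>g\<close> by ultrahomogeneity, and the translates of \<open>X\<close>
  inside \<open>Y\<close> become the copies attached to the products of \<open>g\<close> with
  members of \<open>K\<close>.\<close>

lemma Ramsey_Aut:
  fixes L :: "('f, 'p) lang" and M :: "('m, 'f, 'p) fo_struct" and \<chi> :: "('m \<Rightarrow> 'm) \<Rightarrow> nat"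
  assumes R: "ramsey_structure L M"
    and A: "finite A" "A \<subseteq> univ M"
    and K: "finite K" "K \<subseteq> carrier (Aut L M)"
    and \<chi>k: "\<And>g. \<chi> g < k"
    and \<chi>A: "\<And>g h. g \<in> carrier (Aut L M) \<Longrightarrow> h \<in> carrier (Aut L M) \<Longrightarrow>
      \<forall>a\<in>A. g a = h a \<Longrightarrow> \<chi> g = \<chi> h"
  obtains g i where "g \<in> carrier (Aut L M)" "\<And>\<kappa>. \<kappa> \<in> K \<Longrightarrow> \<chi> (g \<otimes>\<^bsub>Aut L M\<^esub> \<kappa>) = i"
proof -
  have M: "is_struct L M" and lf: "locally_finite L M" and uh: "ultrahomogeneous L M"
    and rc: "ramsey_class L (age L M)" and rig: "\<And>A. A \<in> age L M \<Longrightarrow> rigid L A"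
    using R by (auto simp: ramsey_structure_def)
  interpret group "Aut L M" using M by (rule group_Aut)
  obtain X where X: "finite X" "fn_closed L M X" "A \<subseteq> X"
    using finite_closed_superset[OF M lf A] .
  have XM: "X \<subseteq> univ M" using X by (simp add: fn_closed_def)
  have "\<kappa> ` X \<subseteq> univ M" if "\<kappa> \<in> K" for \<kappa>
    using Aut_in_univ[OF subsetD[OF K(2) that]] XM by blast
  then have "finite (X \<union> (\<Union>\<kappa>\<in>K. \<kappa> ` X))" "X \<union> (\<Union>\<kappa>\<in>K. \<kappa> ` X) \<subseteq> univ M"
    using X(1) K(1) XM by auto
  then obtain Y where Y: "finite Y" "fn_closed L M Y" "X \<union> (\<Union>\<kappa>\<in>K. \<kappa> ` X) \<subseteq> Y"
    using finite_closed_superset[OF M lf] by metis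
  have YM: "Y \<subseteq> univ M" using Y by (simp add: fn_closed_def)
  have age: "induced M Z \<in> age L M" if Z: "finite Z" "fn_closed L M Z" for Z
  proof -
    have "is_iso L (induced M Z) (induced M Z) (\<lambda>z. z)"
      using is_struct_induced[OF Z(2)] by (intro is_iso_id) auto
    then show ?thesis
      using Z is_struct_induced[OF Z(2)] by (auto simp: age_def isomorphic_def)
  qed
  have "substr L (induced M X) (induced M Y)"
    using X Y by (intro substr_induced) auto
  moreover have "\<forall>k::nat. \<forall>B\<in>age L M. \<forall>A. substr L A B \<longrightarrow>
        (\<exists>C\<in>age L M. substr L B C \<and>
           (\<forall>c \<in> copies L C A \<rightarrow> {..<k}.
              \<exists>B'\<in>copies L C B. \<exists>i. \<forall>A'\<in>copies L B' A. c A' = i))"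
    using rc unfolding ramsey_class_def by (elim conjE)
  ultimately have "\<exists>C\<in>age L M. substr L (induced M Y) C \<and>
      (\<forall>c \<in> copies L C (induced M X) \<rightarrow> {..<k}.
        \<exists>B'\<in>copies L C (induced M Y). \<exists>i. \<forall>A'\<in>copies L B' (induced M X). c A' = i)"
    using age[OF Y(1,2)] by simp
  then obtain C where C: "C \<in> age L M"
    and ram: "\<And>c. c \<in> copies L C (induced M X) \<rightarrow> {..<k} \<Longrightarrow>
      \<exists>B'\<in>copies L C (induced M Y). \<exists>i. \<forall>A'\<in>copies L B' (induced M X). c A' = i"
    by (elim bexE conjE) simp
  \<comment> \<open>The Ramsey witness \<open>C\<close> is an abstract member of the age;
    \<open>\<theta>\<close> moves it into \<open>M\<close>, where automorphisms can be compared with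
    it.\<close>
  obtain Z \<theta> where Z: "fn_closed L M Z" and \<theta>: "is_iso L C (induced M Z) \<theta>"
    using C by (auto simp: age_def isomorphic_def)
  have ZM: "Z \<subseteq> univ M" using Z by (simp add: fn_closed_def)
  \<comment> \<open>If no automorphism carries \<open>X\<close> onto the copy, the choice is
    arbitrary, but its colour is still below \<open>k\<close>. For the copies that matter the
    product of \<open>g\<close> and \<open>\<kappa>\<close> is a witness.\<close>
  define c where
    "c A' = \<chi> (SOME g. g \<in> carrier (Aut L M) \<and> g ` X = \<theta> ` univ A')" for A' :: "('m, 'f, 'p) fo_struct"
  have "c \<in> copies L C (induced M X) \<rightarrow> {..<k}"
    by (simp add: c_def \<chi>k)
  from ram[OF this] obtain B' i where B': "B' \<in> copies L C (induced M Y)"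
    and i: "\<And>A'. A' \<in> copies L B' (induced M X) \<Longrightarrow> c A' = i"
    by blast
  obtain U \<phi> where B'_eq: "B' = induced C U" and U: "fn_closed L C U"
    and \<phi>: "is_iso L (induced M Y) B' \<phi>"
    using B' by (auto simp: copies_def isomorphic_def)
  have UC: "U \<subseteq> univ C" using U by (simp add: fn_closed_def)
  have \<theta>U: "fn_closed L M (\<theta> ` U)" "is_iso L B' (induced M (\<theta> ` U)) \<theta>"
    using is_iso_induced[OF \<theta> U] ZM by (simp_all add: fn_closed_induced B'_eq)
  have "finite (\<theta> ` U)"
    using C UC by (auto simp: age_def intro: finite_subset)
  moreover have "is_iso L (induced M Y) (induced M (\<theta> ` U)) (\<lambda>y. \<theta> (\<phi> y))"
    by (rule is_iso_comp[OF \<phi> \<theta>U(2) is_struct_induced[OF Y(2)]]) simp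
  ultimately obtain g where g: "g \<in> carrier (Aut L M)" and gY: "\<And>y. y \<in> Y \<Longrightarrow> g y = \<theta> (\<phi> y)"
    using uh Y(1,2) \<theta>U(1) unfolding ultrahomogeneous_def by metis
  have "\<chi> (g \<otimes>\<^bsub>Aut L M\<^esub> \<kappa>) = i" if \<kappa>: "\<kappa> \<in> K" for \<kappa>
  proof -
    have \<kappa>G: "\<kappa> \<in> carrier (Aut L M)" using \<kappa> K by blast
    have \<kappa>Y: "\<kappa> ` X \<subseteq> Y" using Y(3) \<kappa> by blast
    have cl: "fn_closed L (induced M Y) (\<kappa> ` X)"
      using Aut_induced(1)[OF \<kappa>G X(2)] \<kappa>Y YM by (simp add: fn_closed_induced)
    have iso1: "is_iso L (induced M X) (induced M (\<kappa> ` X)) \<kappa>"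
      by (rule Aut_induced(2)[OF \<kappa>G X(2)])
    have iso2: "fn_closed L B' (\<phi> ` \<kappa> ` X)"
        "is_iso L (induced M (\<kappa> ` X)) (induced B' (\<phi> ` \<kappa> ` X)) \<phi>"
      using is_iso_induced[OF \<phi> cl] by simp_all
    have "is_iso L (induced M X) (induced B' (\<phi> ` \<kappa> ` X)) (\<lambda>a. \<phi> (\<kappa> a))"
      by (rule is_iso_comp[OF iso1 iso2(2) is_struct_induced[OF X(2)]]) simp
    then have "induced B' (\<phi> ` \<kappa> ` X) \<in> copies L B' (induced M X)"
      using iso2(1) unfolding copies_def isomorphic_def by blast
    then have ci: "c (induced B' (\<phi> ` \<kappa> ` X)) = i" by (rule i)
    define g' where "g' = (SOME g. g \<in> carrier (Aut L M) \<and> g ` X = \<theta> ` (\<phi> ` \<kappa> ` X))"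
    have g\<kappa>: "g \<otimes>\<^bsub>Aut L M\<^esub> \<kappa> \<in> carrier (Aut L M)" using g \<kappa>G by simp
    have "(g \<otimes>\<^bsub>Aut L M\<^esub> \<kappa>) a = \<theta> (\<phi> (\<kappa> a))" if "a \<in> X" for a
    proof -
      have "\<kappa> a \<in> Y" "a \<in> univ M" using that \<kappa>Y XM by auto
      then show ?thesis using Aut_mult_apply[OF g \<kappa>G] gY by simp
    qed
    then have im: "(g \<otimes>\<^bsub>Aut L M\<^esub> \<kappa>) ` X = \<theta> ` (\<phi> ` \<kappa> ` X)"
      by (auto simp: image_image)
    have g': "g' \<in> carrier (Aut L M)" "g' ` X = \<theta> ` (\<phi> ` \<kappa> ` X)"
      unfolding g'_def by (rule someI2[of _ "g \<otimes>\<^bsub>Aut L M\<^esub> \<kappa>"]; use g\<kappa> im in simp)+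
    \<comment> \<open>By rigidity the automorphism chosen in \<open>c\<close> agrees with the
      product on \<open>X\<close>, hence on \<open>A\<close>, so the choice does not affect the
      colour.\<close>
    have "\<forall>a\<in>X. g' a = (g \<otimes>\<^bsub>Aut L M\<^esub> \<kappa>) a"
      using rigid_Aut_eq[OF M X(2) rig[OF age[OF X(1,2)]] g'(1) g\<kappa>] g'(2) im by simp
    then have "\<chi> g' = \<chi> (g \<otimes>\<^bsub>Aut L M\<^esub> \<kappa>)"
      using \<chi>A[OF g'(1) g\<kappa>] X(3) by blast
    moreover have "\<chi> g' = i" using ci by (simp add: c_def g'_def)
    ultimately show ?thesis by simp
  qed
  then show thesis using that g by blast
qed

text \<open>Coinduction to the whole group: a colouring \<open>\<chi>\<close> of the open subgroup \<open>H\<close> is extended to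
  \<open>G\<close> by \<open>g \<mapsto> \<chi> (t\<^sup>-\<^sup>1 g)\<close>, where \<open>t\<close> is a chosen representative of \<open>g H\<close>.\<close>

lemma Ramsey_open_subgroup:
  fixes \<chi> :: "('m \<Rightarrow> 'm) \<Rightarrow> nat"
  assumes R: "ramsey_structure L M"
    and A: "finite A" "A \<subseteq> univ M"
    and H: "subgroup H (Aut L M)"
    and HA: "\<And>g. g \<in> carrier (Aut L M) \<Longrightarrow> \<forall>a\<in>A. g a = a \<Longrightarrow> g \<in> H"
    and K: "finite K" "K \<subseteq> H"
    and \<chi>k: "\<And>g. \<chi> g < k"
    and \<chi>A: "\<And>g h. g \<in> H \<Longrightarrow> h \<in> H \<Longrightarrow> \<forall>a\<in>A. g a = h a \<Longrightarrow> \<chi> g = \<chi> h"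
  obtains h i where "h \<in> H" "\<And>\<kappa>. \<kappa> \<in> K \<Longrightarrow> \<chi> (h \<otimes>\<^bsub>Aut L M\<^esub> \<kappa>) = i"
proof -
  have M: "is_struct L M" using R by (simp add: ramsey_structure_def)
  let ?G = "Aut L M"
  interpret group ?G using M by (rule group_Aut)
  have HG: "H \<subseteq> carrier ?G" using H by (rule subgroup.subset)
  \<comment> \<open>Choosing from the coset itself makes \<open>t\<close> constant on left cosets of
    \<open>H\<close>.\<close>
  define t where "t g = (SOME t. t \<in> g <#\<^bsub>?G\<^esub> H)" for g
  have t: "t g \<in> carrier ?G \<and> inv\<^bsub>?G\<^esub> (t g) \<otimes>\<^bsub>?G\<^esub> g \<in> H" if g: "g \<in> carrier ?G" for g
  proof -
    have "g \<in> g <#\<^bsub>?G\<^esub> H"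
      using g H by (auto simp: l_coset_def subgroup.one_closed intro!: bexI[of _ "\<one>\<^bsub>?G\<^esub>"])
    then have "t g \<in> g <#\<^bsub>?G\<^esub> H" unfolding t_def by (rule someI[of "\<lambda>t. t \<in> g <#\<^bsub>?G\<^esub> H"])
    then obtain h where h: "h \<in> H" "t g = g \<otimes>\<^bsub>?G\<^esub> h" by (auto simp: l_coset_def)
    then have "inv\<^bsub>?G\<^esub> (t g) \<otimes>\<^bsub>?G\<^esub> g = inv\<^bsub>?G\<^esub> h"
      using g HG by (auto simp: inv_mult_group m_assoc)
    then show ?thesis using h g HG H subgroup.m_inv_closed[OF H h(1)] by auto
  qed
  have tH: "t (g \<otimes>\<^bsub>?G\<^esub> h) = t g" if "g \<in> carrier ?G" "h \<in> H" for g h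
  proof -
    have "(g \<otimes>\<^bsub>?G\<^esub> h) <#\<^bsub>?G\<^esub> H = g <#\<^bsub>?G\<^esub> (h <#\<^bsub>?G\<^esub> H)"
      using that HG by (simp add: lcos_m_assoc subset_iff)
    also have "h <#\<^bsub>?G\<^esub> H = H"
      by (rule coset_join3) (use that HG H in auto)
    finally show ?thesis by (simp add: t_def)
  qed
  define \<chi>' where "\<chi>' g = \<chi> (inv\<^bsub>?G\<^esub> (t g) \<otimes>\<^bsub>?G\<^esub> g)" for g
  have "\<chi>' g = \<chi>' h"
    if g: "g \<in> carrier ?G" and h: "h \<in> carrier ?G" and eq: "\<forall>a\<in>A. g a = h a" for g h
  proof -
    \<comment> \<open>Two automorphisms that agree on \<open>A\<close> lie in the same left coset
      and share their representative, so the extended colouring still depends only on values on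
      \<open>A\<close>.\<close>
    have "inv\<^bsub>?G\<^esub> g \<otimes>\<^bsub>?G\<^esub> h \<in> H"
    proof (rule HA)
      show "\<forall>a\<in>A. (inv\<^bsub>?G\<^esub> g \<otimes>\<^bsub>?G\<^esub> h) a = a"
        using eq g h A(2) Aut_inv_apply(1)[OF M g] Aut_mult_apply[of "inv\<^bsub>?G\<^esub> g" L M h]
        by (metis inv_closed subsetD)
    qed (use g h in simp)
    then have "t (g \<otimes>\<^bsub>?G\<^esub> (inv\<^bsub>?G\<^esub> g \<otimes>\<^bsub>?G\<^esub> h)) = t g" by (rule tH[OF g])
    then have tt: "t h = t g" using g h by (simp add: m_assoc[symmetric])
    have "(inv\<^bsub>?G\<^esub> (t g) \<otimes>\<^bsub>?G\<^esub> g) a = (inv\<^bsub>?G\<^esub> (t g) \<otimes>\<^bsub>?G\<^esub> h) a" if "a \<in> A" for a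
      using that A(2) eq g h t[OF g] by (simp add: Aut_mult_apply subset_iff)
    then show ?thesis
      unfolding \<chi>'_def using t[OF g] t[OF h] tt by (intro \<chi>A) auto
  qed
  moreover have "K \<subseteq> carrier ?G" using K HG by blast
  moreover have "\<chi>' g < k" for g by (simp add: \<chi>'_def \<chi>k)
  ultimately obtain g i where g: "g \<in> carrier ?G"
    and i: "\<And>\<kappa>. \<kappa> \<in> K \<Longrightarrow> \<chi>' (g \<otimes>\<^bsub>?G\<^esub> \<kappa>) = i"
    using Ramsey_Aut[OF R A K(1), of \<chi>' k] by metis
  show thesis
  proof (rule that)
    show "inv\<^bsub>?G\<^esub> (t g) \<otimes>\<^bsub>?G\<^esub> g \<in> H" using t[OF g] by simp
    show "\<chi> ((inv\<^bsub>?G\<^esub> (t g) \<otimes>\<^bsub>?G\<^esub> g) \<otimes>\<^bsub>?G\<^esub> \<kappa>) = i" if "\<kappa> \<in> K" for \<kappa>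
      using i[OF that] tH[OF g, of \<kappa>] that K HG g t[OF g]
      by (simp add: \<chi>'_def m_assoc subset_iff)
  qed
qed

text \<open>List \<open>A\<close> as \<open>xs\<close> and the support \<open>B\<close> of
  \<open>p\<close> as \<open>ys\<close>. If \<open>k\<close> carries \<open>xs @ map g ys\<close> to
  \<open>xs @ map g' ys\<close>, then \<open>k\<close> fixes \<open>A\<close>, so it lies in
  \<open>H\<close>, and it carries \<open>act g p\<close> to \<open>act g' p\<close>. So the
  \<open>H\<close>-orbit of \<open>act g p\<close> is determined by the \<open>G\<close>-orbit of a
  tuple of fixed length, and there are finitely many of these. The action is abstract because the
  lemma serves both imaginaries and vectors.\<close>

lemma finite_orbits_on_orbit:
  assumes oc: "omega_categorical L M"
    and A: "finite A" "A \<subseteq> univ M"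
    and H: "subgroup (carrier H) (Aut L M)"
    and HA: "\<And>g. g \<in> carrier (Aut L M) \<Longrightarrow> \<forall>a\<in>A. g a = a \<Longrightarrow> g \<in> carrier H"
    and B: "finite B" "B \<subseteq> univ M"
    and supp: "\<And>g h. g \<in> carrier (Aut L M) \<Longrightarrow> h \<in> carrier (Aut L M) \<Longrightarrow>
      \<forall>b\<in>B. g b = h b \<Longrightarrow> act g p = act h p"
    and act: "\<And>g h. g \<in> carrier (Aut L M) \<Longrightarrow> h \<in> carrier (Aut L M) \<Longrightarrow>
      act (g \<otimes>\<^bsub>Aut L M\<^esub> h) p = act g (act h p)"
  shows "finite (orbits H (orbit (Aut L M) act p) act)"
proof -
  let ?G = "Aut L M"
  have M: "is_struct L M" and fin: "\<And>n. finite (orbits ?G (tuples (univ M) n) map)"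
    using oc by (auto simp: omega_categorical_def)
  interpret group ?G using M by (rule group_Aut)
  have HG: "carrier H \<subseteq> carrier ?G" using H by (rule subgroup.subset)
  obtain xs where xs: "set xs = A" using finite_list[OF A(1)] by blast
  obtain ys where ys: "set ys = B" using finite_list[OF B(1)] by blast
  define F where "F g = orbit ?G map (xs @ map g ys)" for g
  define Q where "Q g = orbit H act (act g p)" for g
  have sub: "Q g' \<subseteq> Q g"
    if g: "g \<in> carrier ?G" and g': "g' \<in> carrier ?G" and eq: "F g = F g'" for g g'
  proof -
    have "map \<one>\<^bsub>?G\<^esub> (xs @ map g' ys) = xs @ map g' ys"
      using xs ys A(2) B(2) Aut_in_univ[OF g'] by (intro map_idI Aut_one_apply) auto
    then have "xs @ map g' ys \<in> F g'"
      unfolding F_def orbit_def by (metis (mono_tags, lifting) mem_Collect_eq one_closed)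
    then obtain k where k: "k \<in> carrier ?G" "xs @ map g' ys = map k (xs @ map g ys)"
      unfolding eq[symmetric] by (auto simp: F_def orbit_def)
    have "map k xs = xs" "map g' ys = map k (map g ys)" using k(2) by auto
    then have kA: "\<forall>a\<in>A. k a = a" and kB: "\<forall>b\<in>B. g' b = k (g b)"
      using xs ys by (auto simp: map_eq_conv) (metis map_eq_conv map_ident)
    have kH: "k \<in> carrier H" using HA k(1) kA by blast
    have "act g' p = act (k \<otimes>\<^bsub>?G\<^esub> g) p"
      using kB B(2) g g' k(1) by (intro supp) (auto simp: Aut_mult_apply)
    then have g'p: "act g' p = act k (act g p)" using act g k(1) by simp
    have "act h (act g' p) = act (h \<otimes>\<^bsub>?G\<^esub> k) (act g p)" if "h \<in> carrier H" for h
      using that HG g k(1) unfolding g'p by (simp add: act[symmetric] m_assoc subset_iff)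
    moreover have "h \<otimes>\<^bsub>?G\<^esub> k \<in> carrier H" if "h \<in> carrier H" for h
      using that kH H by (simp add: subgroup.m_closed)
    ultimately show ?thesis unfolding Q_def orbit_def by blast
  qed
  have "F ` carrier ?G \<subseteq> orbits ?G (tuples (univ M) (length xs + length ys)) map"
  proof (clarify)
    fix g assume g: "g \<in> carrier ?G"
    have "xs @ map g ys \<in> tuples (univ M) (length xs + length ys)"
      using xs ys A(2) B(2) Aut_in_univ[OF g] by (auto simp: tuples_def)
    then show "F g \<in> orbits ?G (tuples (univ M) (length xs + length ys)) map"
      unfolding F_def orbits_def by blast
  qed
  then have "finite (F ` carrier ?G)" using fin finite_subset by blast
  \<comment> \<open>Since \<open>Q\<close> is constant where \<open>F\<close> is, it factors through
    the finite image of \<open>F\<close>.\<close>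
  moreover have "Q ` carrier ?G \<subseteq> (\<lambda>s. Q (inv_into (carrier ?G) F s)) ` (F ` carrier ?G)"
  proof (clarify)
    fix g assume g: "g \<in> carrier ?G"
    then have "inv_into (carrier ?G) F (F g) \<in> carrier ?G" "F (inv_into (carrier ?G) F (F g)) = F g"
      by (simp_all add: inv_into_into f_inv_into_f)
    then have "Q g = Q (inv_into (carrier ?G) F (F g))"
      using sub g by (metis subset_antisym)
    then show "Q g \<in> (\<lambda>s. Q (inv_into (carrier ?G) F s)) ` F ` carrier ?G" using g by blast
  qed
  ultimately have "finite (Q ` carrier ?G)" using finite_surj by blast
  moreover have "orbits H (orbit ?G act p) act = Q ` carrier ?G"
    by (auto simp: orbits_def orbit_def Q_def)
  ultimately show ?thesis by simp
qed

section \<open>Characters of abelian groups\<close>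

text \<open>The homomorphism from the integers that sends 1 to \<open>a\<close>. Extending a
  character to \<open>a\<close> only concerns the pullback of its graph along this map.\<close>

lemma ex_int_multiples:
  fixes a :: "'a::ab_group_add"
  obtains \<phi> :: "int \<Rightarrow> 'a" where "\<phi> 1 = a" "\<And>m n. \<phi> (m + n) = \<phi> m + \<phi> n"
proof
  define u where "u n = (\<Sum>i<n. a)" for n :: nat
  define \<phi> where "\<phi> k = u (nat k) - u (nat (- k))" for k :: int
  have u_add: "u (m + n) = u m + u n" for m n
    by (induction m) (simp_all add: u_def ac_simps)
  have diff: "\<phi> (int m - int n) = u m - u n" for m n
  proof -
    have "u (nat (int m - int n)) + u n = u m + u (nat (- (int m - int n)))"
      unfolding u_add[symmetric] by (rule arg_cong[of _ _ u]) linarith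
    then show ?thesis by (simp add: \<phi>_def algebra_simps)
  qed
  show "\<phi> 1 = a" by (simp add: \<phi>_def u_def)
  show "\<phi> (m + n) = \<phi> m + \<phi> n" for m n
  proof -
    obtain m1 m2 n1 n2 where mn: "m = int m1 - int m2" "n = int n1 - int n2"
      by (metis int_diff_cases)
    have "m + n = int (m1 + n1) - int (m2 + n2)" using mn by simp
    then have "\<phi> (m + n) = u (m1 + n1) - u (m2 + n2)" using diff by metis
    then show ?thesis by (simp add: mn diff u_add)
  qed
qed

text \<open>A partial homomorphism to \<open>\<real> / \<int>\<close> is represented by the graph of a
  real-valued lift, a subgroup of the product with \<open>\<real>\<close>.\<close>

definition circle_graph :: "('a::ab_group_add \<times> real) set \<Rightarrow> bool" where
  "circle_graph \<Gamma> \<longleftrightarrow> (0, 0) \<in> \<Gamma> \<and>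
     (\<forall>a r b s. (a, r) \<in> \<Gamma> \<longrightarrow> (b, s) \<in> \<Gamma> \<longrightarrow> (a - b, r - s) \<in> \<Gamma>) \<and>
     (\<forall>r. (0, r) \<in> \<Gamma> \<longrightarrow> r \<in> \<int>)"

lemma circle_graph_zero: "circle_graph \<Gamma> \<Longrightarrow> (0, 0) \<in> \<Gamma>"
  and circle_graph_diff:
    "circle_graph \<Gamma> \<Longrightarrow> (a, r) \<in> \<Gamma> \<Longrightarrow> (b, s) \<in> \<Gamma> \<Longrightarrow> (a - b, r - s) \<in> \<Gamma>"
  and circle_graph_Ints: "circle_graph \<Gamma> \<Longrightarrow> (0, r) \<in> \<Gamma> \<Longrightarrow> r \<in> \<int>"
  by (auto simp: circle_graph_def)

lemma circle_graph_uminus: "circle_graph \<Gamma> \<Longrightarrow> (a, r) \<in> \<Gamma> \<Longrightarrow> (- a, - r) \<in> \<Gamma>"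
  using circle_graph_diff[of \<Gamma> 0 0 a r] circle_graph_zero[of \<Gamma>] by simp

lemma circle_graph_add:
  "circle_graph \<Gamma> \<Longrightarrow> (a, r) \<in> \<Gamma> \<Longrightarrow> (b, s) \<in> \<Gamma> \<Longrightarrow> (a + b, r + s) \<in> \<Gamma>"
  using circle_graph_diff[of \<Gamma> a r "- b" "- s"] circle_graph_uminus[of \<Gamma> b s] by simp

lemma circle_graph_functional:
  "circle_graph \<Gamma> \<Longrightarrow> (a, r) \<in> \<Gamma> \<Longrightarrow> (a, s) \<in> \<Gamma> \<Longrightarrow> r - s \<in> \<int>"
  using circle_graph_diff[of \<Gamma> a r a s] circle_graph_Ints by simp

lemma circle_graph_multiple:
  assumes \<Gamma>: "circle_graph \<Gamma>" and \<phi>: "\<And>m n :: int. \<phi> (m + n) = \<phi> m + \<phi> n"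
    and d: "(\<phi> d, r) \<in> \<Gamma>"
  shows "(\<phi> (q * d), of_int q * r) \<in> \<Gamma>"
proof (induction q rule: int_induct[where k = 0])
  case base
  have "\<phi> 0 = 0" using \<phi>[of 0 0] by simp
  then show ?case using circle_graph_zero[OF \<Gamma>] by simp
next
  case (step1 q)
  then show ?case using circle_graph_add[OF \<Gamma> step1(2) d] by (simp add: \<phi>[symmetric] algebra_simps)
next
  case (step2 q)
  have "\<phi> ((q - 1) * d) = \<phi> (q * d) - \<phi> d"
    using \<phi>[of "(q - 1) * d" d] by (simp add: algebra_simps)
  moreover have "real_of_int (q - 1) * r = of_int q * r - r" by (simp add: algebra_simps)
  ultimately show ?case using circle_graph_diff[OF \<Gamma> step2(2) d] by simp
qed

text \<open>The integers \<open>n\<close> with \<open>\<phi> n\<close> in the domain form a subgroup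
  of the integers, so they are the multiples of some \<open>d\<close>; the value at \<open>d\<close>
  then fixes all others modulo 1. Setting \<open>r = 0\<close> when \<open>d = 0\<close> lets
  \<open>r / d\<close> be used later without a case distinction.\<close>

lemma circle_graph_period:
  assumes \<Gamma>: "circle_graph \<Gamma>" and \<phi>: "\<And>m n :: int. \<phi> (m + n) = \<phi> m + \<phi> n"
  obtains d r where "d \<ge> 0" "(\<phi> d, r) \<in> \<Gamma>" "d = 0 \<Longrightarrow> r = 0"
    "\<And>n s. (\<phi> n, s) \<in> \<Gamma> \<Longrightarrow> \<exists>q. n = q * d \<and> s - of_int q * r \<in> \<int>"
proof (cases "\<exists>n>0. \<exists>r. (\<phi> (int n), r) \<in> \<Gamma>")
  case False
  have \<phi>0: "\<phi> 0 = 0" using \<phi>[of 0 0] by simp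
  have \<phi>m: "\<phi> (- n) = - \<phi> n" for n using \<phi>[of n "- n"] \<phi>0 by (simp add: add_eq_0_iff)
  have "n = 0" if n: "(\<phi> n, s) \<in> \<Gamma>" for n s
  proof (rule ccontr)
    assume "n \<noteq> 0"
    have "(\<phi> (int (nat \<bar>n\<bar>)), if n > 0 then s else - s) \<in> \<Gamma>"
      using n circle_graph_uminus[OF \<Gamma> n] \<phi>m[of n] \<open>n \<noteq> 0\<close> by (auto simp: abs_if)
    then show False using False \<open>n \<noteq> 0\<close> by (metis zero_less_abs_iff zero_less_nat_eq)
  qed
  then show thesis
    using that[of 0 0] \<phi>0 circle_graph_zero[OF \<Gamma>] circle_graph_Ints[OF \<Gamma>] by (metis diff_zero
      mult_zero_left of_int_0 order_refl)
next
  case True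
  define d where "d = (LEAST n. n > 0 \<and> (\<exists>r. (\<phi> (int n), r) \<in> \<Gamma>))"
  have d: "d > 0" "\<exists>r. (\<phi> (int d), r) \<in> \<Gamma>"
    using LeastI_ex[of "\<lambda>n. n > 0 \<and> (\<exists>r. (\<phi> (int n), r) \<in> \<Gamma>)"] True by (auto simp: d_def)
  then obtain r where r: "(\<phi> (int d), r) \<in> \<Gamma>" by blast
  have "\<exists>q. n = q * int d \<and> s - of_int q * r \<in> \<int>" if n: "(\<phi> n, s) \<in> \<Gamma>" for n s
  proof -
    let ?q = "n div int d"
    have q: "(\<phi> (?q * int d), of_int ?q * r) \<in> \<Gamma>"
      by (rule circle_graph_multiple[OF \<Gamma> \<phi> r])
    have "\<phi> n = \<phi> (?q * int d) + \<phi> (n mod int d)" by (simp add: \<phi>[symmetric])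
    then have m: "(\<phi> (n mod int d), s - of_int ?q * r) \<in> \<Gamma>"
      using circle_graph_diff[OF \<Gamma> n q] by simp
    have "n mod int d = 0"
    proof (rule ccontr)
      assume "n mod int d \<noteq> 0"
      then have pos: "nat (n mod int d) > 0" "nat (n mod int d) < d"
        using d(1) pos_mod_bound[of "int d" n] pos_mod_sign[of "int d" n] by linarith+
      then have "\<exists>r. (\<phi> (int (nat (n mod int d))), r) \<in> \<Gamma>"
        using m by auto
      then have "d \<le> nat (n mod int d)"
        unfolding d_def using pos(1) by (intro Least_le) (simp add: d_def)
      then show False using pos(2) by simp
    qed
    then have n_eq: "n = ?q * int d" by (metis add.right_neutral div_mult_mod_eq)
    then have "s - of_int ?q * r \<in> \<int>"
      using circle_graph_functional[OF \<Gamma> n] q by metis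
    then show ?thesis using n_eq by blast
  qed
  then show thesis using that[of "int d" r] d(1) r by simp
qed

text \<open>The new graph is generated by the old one and \<open>(\<phi> 1, s)\<close>. A relation
  \<open>\<phi> n + b = 0\<close> puts \<open>\<phi> n\<close> into the old domain, so the
  hypothesis on \<open>s\<close> is exactly the consistency that is needed.\<close>

lemma circle_graph_extend:
  assumes \<Gamma>: "circle_graph \<Gamma>" and \<phi>: "\<And>m n :: int. \<phi> (m + n) = \<phi> m + \<phi> n"
    and s: "\<And>n r. (\<phi> n, r) \<in> \<Gamma> \<Longrightarrow> of_int n * s - r \<in> \<int>"
  obtains \<Gamma>' where "circle_graph \<Gamma>'" "\<Gamma> \<subseteq> \<Gamma>'" "(\<phi> 1, s) \<in> \<Gamma>'"
proof
  let ?\<Gamma>' = "{(\<phi> n + b, of_int n * s + r) |n b r. (b, r) \<in> \<Gamma>}"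
  have \<phi>0: "\<phi> 0 = 0" using \<phi>[of 0 0] by simp
  have \<phi>d: "\<phi> (m - n) = \<phi> m - \<phi> n" for m n using \<phi>[of "m - n" n] by simp
  have memI: "(\<phi> n + b, of_int n * s + r) \<in> ?\<Gamma>'" if "(b, r) \<in> \<Gamma>" for n b r
    using that by blast
  show "\<Gamma> \<subseteq> ?\<Gamma>'" using memI[of _ _ 0] by (auto simp: \<phi>0)
  show "(\<phi> 1, s) \<in> ?\<Gamma>'" using memI[OF circle_graph_zero[OF \<Gamma>], of 1] by simp
  show "circle_graph ?\<Gamma>'"
    unfolding circle_graph_def
  proof (intro conjI allI impI)
    show "(0, 0) \<in> ?\<Gamma>'" using memI[OF circle_graph_zero[OF \<Gamma>], of 0] \<phi>0 by simp
  next
    fix a r b t assume "(a, r) \<in> ?\<Gamma>'" "(b, t) \<in> ?\<Gamma>'"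
    then obtain m n c q d u where
      eq: "a = \<phi> m + c" "r = of_int m * s + q" "b = \<phi> n + d" "t = of_int n * s + u"
      and "(c, q) \<in> \<Gamma>" "(d, u) \<in> \<Gamma>" by auto
    then have "(\<phi> (m - n) + (c - d), of_int (m - n) * s + (q - u)) \<in> ?\<Gamma>'"
      by (intro memI circle_graph_diff[OF \<Gamma>])
    moreover have "\<phi> (m - n) + (c - d) = a - b" "of_int (m - n) * s + (q - u) = r - t"
      by (simp_all add: eq \<phi>d algebra_simps)
    ultimately show "(a - b, r - t) \<in> ?\<Gamma>'" by simp
  next
    fix r assume "(0, r) \<in> ?\<Gamma>'"
    then obtain n b q where n: "\<phi> n + b = 0" "r = of_int n * s + q" "(b, q) \<in> \<Gamma>" by auto
    then have "(\<phi> n, - q) \<in> \<Gamma>"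
      using circle_graph_uminus[OF \<Gamma> n(3)] by (simp add: add_eq_0_iff2)
    then show "r \<in> \<int>" using s[of n "- q"] n(2) by simp
  qed
qed

text \<open>The circle is divisible, hence an injective abelian group: by Zorn's lemma take a
  maximal partial homomorphism, which cannot be extended by a further element. Choosing real lifts
  leaves \<open>f\<close> additive modulo integers.\<close>

lemma circle_graph_total:
  fixes \<Gamma> :: "('a::ab_group_add \<times> real) set"
  assumes \<Gamma>: "circle_graph \<Gamma>"
  obtains f where "\<And>a b. f (a + b) - f a - f b \<in> \<int>" "\<And>a r. (a, r) \<in> \<Gamma> \<Longrightarrow> f a - r \<in> \<int>"
proof -
  let ?A = "{\<Gamma>'. circle_graph \<Gamma>' \<and> \<Gamma> \<subseteq> \<Gamma>'}"
  have "\<exists>X\<in>?A. \<forall>Y\<in>?A. X \<subseteq> Y \<longrightarrow> Y = X"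
  proof (rule subset_Zorn_nonempty)
    show "?A \<noteq> {}" using \<Gamma> by blast
  next
    fix C assume C: "C \<noteq> {}" "subset.chain ?A C"
    have cg: "circle_graph X" "\<Gamma> \<subseteq> X" if "X \<in> C" for X
      using that C(2) by (auto simp: subset_chain_def)
    have "circle_graph (\<Union>C)"
      unfolding circle_graph_def
    proof (intro conjI allI impI)
      show "(0, 0) \<in> \<Union>C" using C(1) cg circle_graph_zero by blast
      show "r \<in> \<int>" if "(0, r) \<in> \<Union>C" for r
        using that cg circle_graph_Ints by blast
      fix a r b s assume "(a, r) \<in> \<Union>C" "(b, s) \<in> \<Union>C"
      then obtain X Y where XY: "X \<in> C" "Y \<in> C" "(a, r) \<in> X" "(b, s) \<in> Y" by blast
      then have "X \<subseteq> Y \<or> Y \<subseteq> X" using C(2) by (auto simp: subset_chain_def)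
      then show "(a - b, r - s) \<in> \<Union>C"
        using XY cg circle_graph_diff by (metis UnionI subsetD)
    qed
    then show "\<Union>C \<in> ?A" using C(1) cg by blast
  qed
  then obtain X where X: "circle_graph X" "\<Gamma> \<subseteq> X"
    and max: "\<And>Y. circle_graph Y \<Longrightarrow> X \<subseteq> Y \<Longrightarrow> Y = X" by auto
  have "\<exists>s. (a, s) \<in> X" for a
  proof -
    obtain \<phi> where \<phi>1: "\<phi> 1 = a" and \<phi>: "\<And>m n :: int. \<phi> (m + n) = \<phi> m + \<phi> n"
      using ex_int_multiples by blast
    obtain d r where d: "d \<ge> 0" "(\<phi> d, r) \<in> X" "d = 0 \<Longrightarrow> r = 0"
      and dr: "\<And>n s. (\<phi> n, s) \<in> X \<Longrightarrow> \<exists>q. n = q * d \<and> s - of_int q * r \<in> \<int>"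
      using circle_graph_period[OF X(1) \<phi>] by metis
    \<comment> \<open>Divisibility enters here: \<open>r / d\<close> solves the equation for the
      value at \<open>a\<close>. For \<open>d = 0\<close> it is 0, one of the unconstrained
      choices.\<close>
    have "of_int n * (r / of_int d) - s \<in> \<int>" if ns: "(\<phi> n, s) \<in> X" for n s
    proof -
      obtain q where q: "n = q * d" "s - of_int q * r \<in> \<int>" using dr[OF ns] by blast
      have "of_int n * (r / of_int d) = of_int q * r" using q(1) d(3) by auto
      then show ?thesis using Ints_minus[OF q(2)] by simp
    qed
    then obtain Y where "circle_graph Y" "X \<subseteq> Y" "(\<phi> 1, r / of_int d) \<in> Y"
      using circle_graph_extend[OF X(1) \<phi>, of "r / of_int d"] by metis
    then show ?thesis using max \<phi>1 by blast
  qed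
  then obtain f where f: "\<And>a. (a, f a) \<in> X" by metis
  show thesis
  proof
    show "f (a + b) - f a - f b \<in> \<int>" for a b
      using circle_graph_functional[OF X(1) f[of "a + b"] circle_graph_add[OF X(1) f[of a] f[of b]]]
      by (simp add: algebra_simps)
    show "f a - r \<in> \<int>" if "(a, r) \<in> \<Gamma>" for a r
      using circle_graph_functional[OF X(1) f] that X(2) by blast
  qed
qed

text \<open>The distance \<open>1 / 4\<close> does not depend on the group: a nontrivial cyclic subgroup of the
  circle contains an element at distance at least \<open>1 / 3\<close> from the identity.\<close>

lemma separating_character:
  fixes N :: "'a::ab_group_add set"
  assumes N: "0 \<in> N" "\<And>a b. a \<in> N \<Longrightarrow> b \<in> N \<Longrightarrow> a - b \<in> N" and x: "x \<notin> N"
  obtains f :: "'a \<Rightarrow> real" where "\<And>a b. f (a + b) - f a - f b \<in> \<int>"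
    "\<And>a. a \<in> N \<Longrightarrow> f a \<in> \<int>" "\<And>k :: int. \<bar>f x - of_int k\<bar> \<ge> 1 / 4"
proof -
  let ?\<Gamma> = "N \<times> {0 :: real}"
  have \<Gamma>: "circle_graph ?\<Gamma>" using N by (auto simp: circle_graph_def)
  obtain \<phi> where \<phi>1: "\<phi> 1 = x" and \<phi>: "\<And>m n :: int. \<phi> (m + n) = \<phi> m + \<phi> n"
    using ex_int_multiples by blast
  obtain d r where d: "d \<ge> 0" "(\<phi> d, r) \<in> ?\<Gamma>"
    and dr: "\<And>n s. (\<phi> n, s) \<in> ?\<Gamma> \<Longrightarrow> \<exists>q. n = q * d \<and> s - of_int q * r \<in> \<int>"
    using circle_graph_period[OF \<Gamma> \<phi>] by metis
  have d1: "d \<noteq> 1" using d(2) \<phi>1 x by auto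
  \<comment> \<open>Here \<open>d\<close> is the order of \<open>x\<close> modulo \<open>N\<close>,
    with 0 for infinite order, and \<open>x\<close> outside \<open>N\<close> excludes 1. Among the
    multiples of \<open>1 / d\<close> the one just below or at \<open>1 / 2\<close> is farthest from
    the integers; for infinite order \<open>1 / 2\<close> itself is allowed.\<close>
  define s :: real where "s = (if d = 0 then 1 / 2 else of_int (d div 2) / of_int d)"
  have s14: "1 / 4 \<le> s \<and> s \<le> 1 / 2"
  proof (cases "d = 0")
    case False
    then have "d \<ge> 2" using d(1) d1 by linarith
    then have "4 * (d div 2) \<ge> d" "2 * (d div 2) \<le> d" by linarith+
    then have "4 * real_of_int (d div 2) \<ge> of_int d" "2 * real_of_int (d div 2) \<le> of_int d"
      by linarith+
    then show ?thesis using False \<open>d \<ge> 2\<close> by (simp add: s_def field_simps)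
  qed (simp add: s_def)
  have "of_int n * s - q \<in> \<int>" if nq: "(\<phi> n, q) \<in> ?\<Gamma>" for n q
  proof -
    obtain m where m: "n = m * d" using dr[OF nq] by blast
    have "of_int n * s = of_int (m * (d div 2))" using m by (simp add: s_def)
    then show ?thesis using nq by simp
  qed
  then obtain \<Gamma>' where \<Gamma>': "circle_graph \<Gamma>'" "?\<Gamma> \<subseteq> \<Gamma>'" "(x, s) \<in> \<Gamma>'"
    using circle_graph_extend[OF \<Gamma> \<phi>, of s] \<phi>1 by metis
  obtain f where f: "\<And>a b. f (a + b) - f a - f b \<in> \<int>" "\<And>a r. (a, r) \<in> \<Gamma>' \<Longrightarrow> f a - r \<in> \<int>"
    using circle_graph_total[OF \<Gamma>'(1)] by metis
  show thesis
  proof (rule that[OF f(1)])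
    show "f a \<in> \<int>" if "a \<in> N" for a using f(2)[of a 0] that \<Gamma>'(2) by auto
    obtain j where j: "f x - s = of_int j" using f(2)[OF \<Gamma>'(3)] by (auto elim: Ints_cases)
    show "\<bar>f x - of_int k\<bar> \<ge> 1 / 4" for k :: int
    proof (cases "k \<le> j")
      case True
      then have "real_of_int k \<le> of_int j" by simp
      then show ?thesis using j s14 by linarith
    next
      case False
      then have "real_of_int (j + 1) \<le> of_int k" by (simp only: of_int_le_iff)
      then show ?thesis using j s14 by (simp add: abs_if)
    qed
  qed
qed

section \<open>Rounding on the circle: equal arc indices mean closeness, and errors add up in finite
  sums\<close>

lemma close_mod_Ints:
  fixes r s :: real
  assumes n: "n > 0" and eq: "\<lfloor>real n * frac r\<rfloor> = \<lfloor>real n * frac s\<rfloor>"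
  obtains k :: int where "\<bar>r - s - of_int k\<bar> < 1 / n"
proof
  have "\<bar>real n * frac r - real n * frac s\<bar> < 1" using eq by linarith
  also have "real n * frac r - real n * frac s = real n * (r - s - of_int (\<lfloor>r\<rfloor> - \<lfloor>s\<rfloor>))"
    by (simp add: frac_def algebra_simps)
  finally have "real n * \<bar>r - s - of_int (\<lfloor>r\<rfloor> - \<lfloor>s\<rfloor>)\<bar> < 1"
    by (simp add: abs_mult)
  then show "\<bar>r - s - of_int (\<lfloor>r\<rfloor> - \<lfloor>s\<rfloor>)\<bar> < 1 / n"
    using n by (simp add: pos_less_divide_eq mult.commute)
qed

lemma sum_mod_Ints:
  fixes f :: "'a::ab_group_add \<Rightarrow> real"
  assumes f: "\<And>a b. f (a + b) - f a - f b \<in> \<int>"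
  shows "f (sum g T) - (\<Sum>t\<in>T. f (g t)) \<in> \<int>"
proof -
  have f0: "f 0 \<in> \<int>" using f[of 0 0] by (simp add: minus_in_Ints_iff)
  show ?thesis
  proof (induction T rule: infinite_finite_induct)
    case (insert t T)
    have "f (g t + sum g T) - f (g t) - f (sum g T) + (f (sum g T) - (\<Sum>t\<in>T. f (g t))) \<in> \<int>"
      by (intro Ints_add f insert.IH)
    then show ?case using insert.hyps by (simp add: algebra_simps)
  qed (use f0 in auto)
qed

lemma sum_close_mod_Ints:
  fixes f :: "'a::ab_group_add \<Rightarrow> real"
  assumes f: "\<And>a b. f (a + b) - f a - f b \<in> \<int>" and e: "e > 0"
    and close: "\<And>t. t \<in> T \<Longrightarrow> \<exists>k :: int. \<bar>f (g t) - f (h t) - of_int k\<bar> < e"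
  obtains k :: int where "\<bar>f (sum g T) - f (sum h T) - of_int k\<bar> \<le> real (card T) * e"
proof -
  obtain k where k: "\<And>t. t \<in> T \<Longrightarrow> \<bar>f (g t) - f (h t) - of_int (k t)\<bar> < e"
    using close by metis
  obtain i j where i: "f (sum g T) - (\<Sum>t\<in>T. f (g t)) = of_int i"
    and j: "f (sum h T) - (\<Sum>t\<in>T. f (h t)) = of_int j"
    using sum_mod_Ints[OF f] by (metis Ints_cases)
  have "f (sum g T) - f (sum h T) - of_int (i - j + (\<Sum>t\<in>T. k t))
      = (\<Sum>t\<in>T. f (g t) - f (h t) - of_int (k t))"
    using i j by (simp add: sum_subtractf)
  also have "\<bar>\<dots>\<bar> \<le> (\<Sum>t\<in>T. e)"
    by (rule order_trans[OF sum_abs sum_mono]) (use k less_imp_le in blast)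
  finally show thesis by (intro that[of "i - j + (\<Sum>t\<in>T. k t)"]) simp
qed

section \<open>Permutation modules\<close>

lemma lookup_smul [simp]: "Poly_Mapping.lookup (smul r x) w = r * Poly_Mapping.lookup x w"
  by (simp add: smul_def Poly_Mapping.map.rep_eq when_def)

lemma smul_add: "smul r (x + y) = smul r x + smul r y"
  by (rule poly_mapping_eqI) (simp add: lookup_add algebra_simps)

lemma smul_0_right [simp]: "smul r 0 = 0"
  and smul_0_left [simp]: "smul 0 x = 0"
  by (rule poly_mapping_eqI, simp)+

lemma smul_1 [simp]: "smul 1 x = (x :: 'w \<Rightarrow>\<^sub>0 'r::{comm_ring, comm_monoid_mult})"
  by (rule poly_mapping_eqI) simp

lemma smul_minus_1: "smul (- 1) x = - (x :: 'w \<Rightarrow>\<^sub>0 'r::{comm_ring, comm_monoid_mult})"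
  by (rule poly_mapping_eqI) simp

lemma smul_sum: "smul r (sum f T) = (\<Sum>t\<in>T. smul r (f t))"
  by (induction T rule: infinite_finite_induct) (auto simp: smul_add)

lemma smul_single: "smul r (Poly_Mapping.single w c) = Poly_Mapping.single w (r * c)"
  by (rule poly_mapping_eqI) (simp add: lookup_single when_def)

lemma keys_smul: "Poly_Mapping.keys (smul r x) \<subseteq> Poly_Mapping.keys x"
  by (auto simp: in_keys_iff)

lemma sum_single:
  assumes "finite T" "Poly_Mapping.keys x \<subseteq> T"
  shows "(\<Sum>w\<in>T. Poly_Mapping.single w (Poly_Mapping.lookup x w)) = x"
proof (rule poly_mapping_eqI)
  fix u
  have "(\<Sum>w\<in>T. Poly_Mapping.lookup x w when w = u) = (if u \<in> T then Poly_Mapping.lookup x u else 0)"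
    using assms(1) by (simp add: when_def)
  also have "\<dots> = Poly_Mapping.lookup x u"
    using assms(2) by (auto simp: in_keys_iff)
  finally show "Poly_Mapping.lookup (\<Sum>w\<in>T. Poly_Mapping.single w (Poly_Mapping.lookup x w)) u =
      Poly_Mapping.lookup x u"
    by (simp add: lookup_sum lookup_single)
qed

lemma free_module_0: "0 \<in> free_module W"
  and free_module_add: "x \<in> free_module W \<Longrightarrow> y \<in> free_module W \<Longrightarrow> x + y \<in> free_module W"
  and free_module_smul: "x \<in> free_module W \<Longrightarrow> smul r x \<in> free_module W"
  and free_module_single: "w \<in> W \<Longrightarrow> Poly_Mapping.single w c \<in> free_module W"
  using keys_add[of x y] keys_smul[of r x] by (auto simp: free_module_def)

lemma free_module_sum:
  fixes f :: "'t \<Rightarrow> 'w \<Rightarrow>\<^sub>0 'r::comm_ring"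
  shows "(\<And>t. t \<in> T \<Longrightarrow> f t \<in> free_module W) \<Longrightarrow> sum f T \<in> free_module W"
  by (induction T rule: infinite_finite_induct) (auto simp: free_module_0 free_module_add)

text \<open>Cancellation can make the keys of a sum smaller than the union of the keys. Additivity
  is therefore checked over a common finite superset, here and in
  \<open>Omega_superset\<close>.\<close>

lemma lin_act_superset:
  assumes "finite T" "Poly_Mapping.keys x \<subseteq> T"
  shows "lin_act act g x = (\<Sum>w\<in>T. Poly_Mapping.single (act g w) (Poly_Mapping.lookup x w))"
  unfolding lin_act_def using assms
  by (intro sum.mono_neutral_left) (auto simp: in_keys_iff)

lemma lin_act_add: "lin_act act g (x + y) = lin_act act g x + lin_act act g y"
proof -
  let ?T = "Poly_Mapping.keys x \<union> Poly_Mapping.keys y"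
  have "Poly_Mapping.keys (x + y) \<subseteq> ?T" by (rule keys_add)
  then show ?thesis
    using lin_act_superset[of ?T "x + y" act g] lin_act_superset[of ?T x act g]
      lin_act_superset[of ?T y act g]
    by (simp add: lookup_add single_add sum.distrib)
qed

lemma lin_act_0 [simp]: "lin_act act g 0 = 0"
  by (simp add: lin_act_def)

lemma lin_act_single [simp]:
  "lin_act act g (Poly_Mapping.single w c) = Poly_Mapping.single (act g w) c"
  using lin_act_superset[of "{w}" "Poly_Mapping.single w c" act g] by (simp split: if_splits)

lemma lin_act_sum: "lin_act act g (sum f T) = (\<Sum>t\<in>T. lin_act act g (f t))"
  by (induction T rule: infinite_finite_induct) (auto simp: lin_act_add)

lemma lin_act_smul: "lin_act act g (smul r x) = smul r (lin_act act g x)"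
proof -
  have "lin_act act g (smul r x) =
      (\<Sum>w\<in>Poly_Mapping.keys x. Poly_Mapping.single (act g w) (r * Poly_Mapping.lookup x w))"
    using lin_act_superset[of "Poly_Mapping.keys x" "smul r x" act g] keys_smul[of r x] by simp
  then show ?thesis by (simp add: lin_act_def[of act g x] smul_sum smul_single)
qed

lemma lin_act_in_free_module:
  "(\<And>w. w \<in> Poly_Mapping.keys x \<Longrightarrow> act g w \<in> W) \<Longrightarrow> lin_act act g x \<in> free_module W"
  unfolding lin_act_def by (intro free_module_sum free_module_single)

lemma lin_act_cong:
  "(\<And>w. w \<in> Poly_Mapping.keys x \<Longrightarrow> act g w = act h w) \<Longrightarrow> lin_act act g x = lin_act act h x"
  unfolding lin_act_def by (intro sum.cong) auto

lemma lin_act_comp: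
  assumes "\<And>w. w \<in> Poly_Mapping.keys x \<Longrightarrow> act k w = act g (act h w)"
  shows "lin_act act k x = lin_act act g (lin_act act h x)"
proof -
  have "lin_act act g (lin_act act h x) = (\<Sum>w\<in>Poly_Mapping.keys x.
      Poly_Mapping.single (act g (act h w)) (Poly_Mapping.lookup x w))"
    unfolding lin_act_def[of act h] by (simp add: lin_act_sum)
  then show ?thesis using assms by (simp add: lin_act_def[of act k])
qed

lemma lin_act_id:
  assumes "\<And>w. w \<in> Poly_Mapping.keys x \<Longrightarrow> act g w = w"
  shows "lin_act act g x = x"
  using sum_single[of "Poly_Mapping.keys x" x] assms by (simp add: lin_act_def)

lemma gr_act_single: "gr_act act (Poly_Mapping.single g r) x = smul r (lin_act act g x)"
  by (simp add: gr_act_def)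

lemma RG_submodule_smul_act:
  assumes "RG_submodule G act W U" "g \<in> carrier G" "x \<in> U"
  shows "smul r (lin_act act g x) \<in> U"
proof -
  have "Poly_Mapping.single g r \<in> free_module (carrier G)"
    using assms(2) by (rule free_module_single)
  then show ?thesis
    using assms(1,3) unfolding RG_submodule_def gr_act_single[symmetric] by blast
qed

lemma RG_submodule_act:
  "RG_submodule G act W U \<Longrightarrow> g \<in> carrier G \<Longrightarrow> x \<in> U \<Longrightarrow> lin_act act g x \<in> U"
  using RG_submodule_smul_act[of G act W U g x 1] by simp

section \<open>The map \<open>Omega\<close>: linearity, and invariance under permutations preserving
  each class\<close>

lemma Omega_superset:
  assumes "finite T" "Poly_Mapping.keys y \<subseteq> T"
  shows "Omega Ws y i = (if i < length Ws then \<Sum>w\<in>T \<inter> Ws ! i. Poly_Mapping.lookup y w else 0)"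
  unfolding Omega_def using assms
  by (auto intro!: sum.mono_neutral_left simp: in_keys_iff)

lemma Omega_add: "Omega Ws (x + y) = (\<lambda>i. Omega Ws x i + Omega Ws y i)"
proof
  fix i
  let ?T = "Poly_Mapping.keys x \<union> Poly_Mapping.keys y"
  have "Poly_Mapping.keys (x + y) \<subseteq> ?T" by (rule keys_add)
  then show "Omega Ws (x + y) i = Omega Ws x i + Omega Ws y i"
    using Omega_superset[of ?T "x + y"] Omega_superset[of ?T x] Omega_superset[of ?T y]
    by (simp add: lookup_add sum.distrib)
qed

lemma Omega_smul: "Omega Ws (smul r x) = (\<lambda>i. r * Omega Ws x i)"
proof
  fix i
  show "Omega Ws (smul r x) i = r * Omega Ws x i"
    using Omega_superset[OF finite_keys keys_smul[of r x]]
      Omega_superset[OF finite_keys order_refl, of Ws x]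
    by (simp add: sum_distrib_left)
qed

lemma Omega_0 [simp]: "Omega Ws 0 = (\<lambda>i. 0)"
  by (simp add: Omega_def fun_eq_iff)

lemma Omega_sum: "Omega Ws (sum f T) = (\<lambda>i. \<Sum>t\<in>T. Omega Ws (f t) i)"
  by (induction T rule: infinite_finite_induct) (auto simp: Omega_add)

lemma Omega_single:
  "Omega Ws (Poly_Mapping.single w c) i = (if i < length Ws \<and> w \<in> Ws ! i then c else 0)"
  by (simp add: Omega_def)

lemma Omega_lin_act:
  assumes "\<And>w i. w \<in> Poly_Mapping.keys x \<Longrightarrow> i < length Ws \<Longrightarrow> act h w \<in> Ws ! i \<longleftrightarrow> w \<in> Ws ! i"
  shows "Omega Ws (lin_act act h x) = Omega Ws x"
proof -
  have "Omega Ws x = Omega Ws (\<Sum>w\<in>Poly_Mapping.keys x. Poly_Mapping.single w (Poly_Mapping.lookup x w))"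
    by (simp add: sum_single)
  also have "\<dots> = Omega Ws (lin_act act h x)"
    using assms by (auto simp: lin_act_def Omega_sum Omega_single fun_eq_iff intro!: sum.cong)
  finally show ?thesis by simp
qed

section \<open>Orbits, sorts and stabilisers\<close>

lemma orbitI: "g \<in> carrier H \<Longrightarrow> act g p \<in> orbit H act p"
  unfolding orbit_def by blast

lemma orbit_mem_eq:
  assumes G: "group G" and H: "subgroup (carrier H) G"
    and act: "\<And>g h. g \<in> carrier H \<Longrightarrow> h \<in> carrier H \<Longrightarrow> act (g \<otimes>\<^bsub>G\<^esub> h) p = act g (act h p)"
    and one: "act \<one>\<^bsub>G\<^esub> p = p" and q: "q \<in> orbit H act p"
  shows "orbit H act q = orbit H act p"
proof -
  interpret group G by (rule G)
  obtain k where k: "k \<in> carrier H" "q = act k p" using q by (auto simp: orbit_def)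
  have HG: "carrier H \<subseteq> carrier G" using H by (rule subgroup.subset)
  show ?thesis
  proof
    show "orbit H act q \<subseteq> orbit H act p"
    proof
      fix u assume "u \<in> orbit H act q"
      then obtain h where h: "h \<in> carrier H" "u = act h q" by (auto simp: orbit_def)
      then have "u = act (h \<otimes>\<^bsub>G\<^esub> k) p" using act k by simp
      then show "u \<in> orbit H act p"
        using orbitI[OF subgroup.m_closed[OF H h(1) k(1)]] by simp
    qed
    show "orbit H act p \<subseteq> orbit H act q"
    proof
      fix u assume "u \<in> orbit H act p"
      then obtain h where h: "h \<in> carrier H" "u = act h p" by (auto simp: orbit_def)
      have hk: "h \<otimes>\<^bsub>G\<^esub> inv\<^bsub>G\<^esub> k \<in> carrier H"
        using h k H by (simp add: subgroup.m_closed subgroup.m_inv_closed)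
      have "act (h \<otimes>\<^bsub>G\<^esub> inv\<^bsub>G\<^esub> k) q = act ((h \<otimes>\<^bsub>G\<^esub> inv\<^bsub>G\<^esub> k) \<otimes>\<^bsub>G\<^esub> k) p"
        using act[OF hk k(1)] k(2) by simp
      also have "(h \<otimes>\<^bsub>G\<^esub> inv\<^bsub>G\<^esub> k) \<otimes>\<^bsub>G\<^esub> k = h"
        using h(1) k(1) HG by (auto simp: m_assoc subset_iff)
      finally show "u \<in> orbit H act q" using h(2) orbitI[OF hk, of act q] by simp
    qed
  qed
qed

lemma is_sort_imaginaries:
  assumes M: "is_struct L M" and W: "is_sort L M W"
  shows "W \<subseteq> imaginaries L M"
proof
  fix w assume "w \<in> W"
  then obtain u where u: "u \<in> imaginaries L M" "w \<in> orbit (Aut L M) act_eq u"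
    using W by (auto simp: is_sort_def orbits_def)
  then show "w \<in> imaginaries L M"
    using act_eq_imaginary[OF M u(1)] by (auto simp: orbit_def)
qed

lemma is_sort_act:
  assumes M: "is_struct L M" and W: "is_sort L M W"
    and g: "g \<in> carrier (Aut L M)" and w: "w \<in> W"
  shows "act_eq g w \<in> W"
proof -
  interpret group "Aut L M" using M by (rule group_Aut)
  obtain Os where Os: "Os \<subseteq> orbits (Aut L M) (imaginaries L M) act_eq" "W = \<Union>Os"
    using W by (auto simp: is_sort_def)
  obtain Q where Q: "Q \<in> Os" "w \<in> Q" using w Os by blast
  then obtain u where u: "u \<in> imaginaries L M" "Q = orbit (Aut L M) act_eq u"
    using Os(1) by (auto simp: orbits_def)
  then obtain k where k: "k \<in> carrier (Aut L M)" "w = act_eq k u"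
    using Q(2) by (auto simp: orbit_def)
  have "act_eq g w = act_eq (g \<otimes>\<^bsub>Aut L M\<^esub> k) u"
    using act_eq_mult[OF u(1) g k(1)] k(2) by simp
  then have "act_eq g w \<in> Q" using u(2) g k(1) by (auto simp: orbit_def)
  then show ?thesis using Q(1) Os(2) by blast
qed

lemma act_eq_support_finite:
  assumes M: "is_struct L M" and T: "finite T" "T \<subseteq> imaginaries L M"
  obtains A where "finite A" "A \<subseteq> univ M"
    "\<And>g h w. g \<in> carrier (Aut L M) \<Longrightarrow> h \<in> carrier (Aut L M) \<Longrightarrow> \<forall>a\<in>A. g a = h a \<Longrightarrow>
      w \<in> T \<Longrightarrow> act_eq g w = act_eq h w"
proof -
  have "\<exists>A. finite A \<and> A \<subseteq> univ M \<and> (\<forall>g\<in>carrier (Aut L M). \<forall>h\<in>carrier (Aut L M).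
      (\<forall>a\<in>A. g a = h a) \<longrightarrow> act_eq g w = act_eq h w)" if w: "w \<in> T" for w
  proof -
    have "w \<in> imaginaries L M" using w T(2) by blast
    from act_eq_support[OF M this] show ?thesis by metis
  qed
  then obtain A where A: "\<And>w. w \<in> T \<Longrightarrow> finite (A w) \<and> A w \<subseteq> univ M \<and>
      (\<forall>g\<in>carrier (Aut L M). \<forall>h\<in>carrier (Aut L M).
        (\<forall>a\<in>A w. g a = h a) \<longrightarrow> act_eq g w = act_eq h w)"
    by metis
  show thesis
  proof
    show "finite (\<Union>w\<in>T. A w)" "(\<Union>w\<in>T. A w) \<subseteq> univ M" using A T(1) by blast+
  next
    fix g h w
    assume "g \<in> carrier (Aut L M)" "h \<in> carrier (Aut L M)" "\<forall>a\<in>(\<Union>w\<in>T. A w). g a = h a" "w \<in> T"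
    then show "act_eq g w = act_eq h w" using A[of w] by blast
  qed
qed

lemma carrier_pointwise_stabilizer [simp]:
  "carrier (pointwise_stabilizer G act A) = {g \<in> carrier G. \<forall>a\<in>A. act g a = a}"
  by (simp add: pointwise_stabilizer_def)

lemma subgroup_stabilizer:
  assumes M: "is_struct L M" and S: "S \<subseteq> imaginaries L M"
  shows "subgroup (carrier (pointwise_stabilizer (Aut L M) act_eq S)) (Aut L M)"
proof -
  interpret group "Aut L M" using M by (rule group_Aut)
  show ?thesis
  proof (rule subgroupI)
    show "carrier (pointwise_stabilizer (Aut L M) act_eq S) \<noteq> {}"
      using act_eq_one S by (auto intro!: exI[of _ "\<one>\<^bsub>Aut L M\<^esub>"])
  next
    fix g assume g: "g \<in> carrier (pointwise_stabilizer (Aut L M) act_eq S)"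
    have "act_eq (inv\<^bsub>Aut L M\<^esub> g) a = a" if a: "a \<in> S" for a
    proof -
      have aI: "a \<in> imaginaries L M" using a S by blast
      have "act_eq (inv\<^bsub>Aut L M\<^esub> g) (act_eq g a) = act_eq (inv\<^bsub>Aut L M\<^esub> g \<otimes>\<^bsub>Aut L M\<^esub> g) a"
        by (rule act_eq_mult[OF aI, symmetric]) (use g in auto)
      then show ?thesis using g a aI by (simp add: act_eq_one)
    qed
    then show "inv\<^bsub>Aut L M\<^esub> g \<in> carrier (pointwise_stabilizer (Aut L M) act_eq S)" using g by simp
  next
    fix g h assume g: "g \<in> carrier (pointwise_stabilizer (Aut L M) act_eq S)"
      and h: "h \<in> carrier (pointwise_stabilizer (Aut L M) act_eq S)"
    have "act_eq (g \<otimes>\<^bsub>Aut L M\<^esub> h) a = a" if a: "a \<in> S" for a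
      using act_eq_mult[of a L M g h] a S g h by auto
    then show "g \<otimes>\<^bsub>Aut L M\<^esub> h \<in> carrier (pointwise_stabilizer (Aut L M) act_eq S)"
      using g h by simp
  qed simp
qed

section \<open>The membership criterion\<close>

lemma finite_orbits_Union:
  assumes "finite Ps" "\<And>P. P \<in> Ps \<Longrightarrow> finite (orbits H P act)"
  shows "finite (orbits H (\<Union>Ps) act)"
proof -
  have "orbits H (\<Union>Ps) act = (\<Union>P\<in>Ps. orbits H P act)" by (auto simp: orbits_def)
  then show ?thesis using assms by simp
qed

text \<open>Formulated for an arbitrary submodule \<open>U\<close>, so that it applies to each
  submodule containing \<open>vs\<close>; membership in the hull is then immediate.\<close>

lemma mem_submodule_if_Omega_eq:
  fixes x y :: "'m list set \<Rightarrow>\<^sub>0 'r::{comm_ring, comm_monoid_mult}"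
  assumes R: "ramsey_structure L M" and W: "is_sort L M W"
    and x: "x \<in> free_module W"
    and H: "H = pointwise_stabilizer (Aut L M) act_eq (Poly_Mapping.keys x)"
    and Ws: "set Ws = orbits H W act_eq"
    and U: "RG_submodule (Aut L M) act_eq W U" and y: "y \<in> U"
    and eq: "Omega Ws x = Omega Ws y"
  shows "x \<in> U"
proof (rule ccontr)
  assume xU: "x \<notin> U"
  let ?G = "Aut L M"
  have M: "is_struct L M" using R by (simp add: ramsey_structure_def)
  interpret group ?G using M by (rule group_Aut)
  have WI: "W \<subseteq> imaginaries L M" using is_sort_imaginaries[OF M W] .
  have xW: "Poly_Mapping.keys x \<subseteq> W" using x by (simp add: free_module_def)
  have UW: "U \<subseteq> free_module W" using U by (simp add: RG_submodule_def)
  have yW: "Poly_Mapping.keys y \<subseteq> W" using y UW by (auto simp: free_module_def)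
  have U_smul: "smul r u \<in> U" if "u \<in> U" for r u
  proof -
    have "lin_act act_eq \<one>\<^bsub>?G\<^esub> u = u"
      using that UW WI by (intro lin_act_id act_eq_one) (auto simp: free_module_def)
    then show ?thesis using RG_submodule_smul_act[OF U one_closed that, of r] by simp
  qed
  have U_diff: "u - v \<in> U" if "u \<in> U" "v \<in> U" for u v
  proof -
    have "u + smul (- 1) v \<in> U"
      using that U U_smul unfolding RG_submodule_def by blast
    then show ?thesis by (simp add: smul_minus_1)
  qed
  have "0 \<in> U" using U by (simp add: RG_submodule_def)
  then obtain f :: "_ \<Rightarrow> real" where f: "\<And>a b. f (a + b) - f a - f b \<in> \<int>"
    and fU: "\<And>a. a \<in> U \<Longrightarrow> f a \<in> \<int>" and fx: "\<And>k :: int. \<bar>f x - of_int k\<bar> \<ge> 1 / 4"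
    using separating_character[OF _ U_diff xU] by metis
  have sub: "subgroup (carrier H) ?G"
    unfolding H using xW WI by (intro subgroup_stabilizer[OF M]) auto
  have HG: "carrier H \<subseteq> carrier ?G" using sub by (rule subgroup.subset)
  have actH: "act_eq (g \<otimes>\<^bsub>?G\<^esub> h) w = act_eq g (act_eq h w)"
    if "w \<in> W" "g \<in> carrier H" "h \<in> carrier H" for g h w
    using that WI HG by (intro act_eq_mult) auto
  have orb_eq: "orbit H act_eq v = orbit H act_eq w" if "w \<in> W" "v \<in> orbit H act_eq w" for v w
    using that(2) actH[OF that(1)] act_eq_one[of w L M] WI that(1)
    by (intro orbit_mem_eq[OF group_Aut[OF M] sub]) auto
  have refl: "w \<in> orbit H act_eq w" if "w \<in> W" for w
    using orbitI[of "\<one>\<^bsub>?G\<^esub>" H act_eq w] subgroup.one_closed[OF sub] act_eq_one[of w L M] that WI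
    by auto

  define z where "z = y - x"
  define T where "T = Poly_Mapping.keys z"
  let ?c = "Poly_Mapping.lookup z"
  have T: "finite T" "T \<subseteq> W"
  proof -
    have "T \<subseteq> Poly_Mapping.keys y \<union> Poly_Mapping.keys x"
      by (auto simp: T_def z_def in_keys_iff lookup_minus)
    then show "T \<subseteq> W" using xW yW by blast
  qed (simp add: T_def)
  have Omega_z: "Omega Ws z i = 0" for i
  proof -
    have "Omega Ws (z + x) i = Omega Ws y i" by (simp add: z_def)
    then show ?thesis using eq by (simp add: Omega_add)
  qed
  \<comment> \<open>The choice depends only on the orbit. Replacing each \<open>w\<close> in
    \<open>z\<close> by \<open>rep w\<close> gives 0, so \<open>z\<close> is the sum of the
    differences \<open>c w - c (rep w)\<close>.\<close>
  define rep where "rep w = (SOME u. u \<in> orbit H act_eq w)" for w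
  have rep: "rep w \<in> orbit H act_eq w" if "w \<in> W" for w
    unfolding rep_def using refl[OF that] by (rule someI[of "\<lambda>u. u \<in> orbit H act_eq w"])
  have rep_cong: "rep v = rep w \<longleftrightarrow> v \<in> orbit H act_eq w" if "v \<in> W" "w \<in> W" for v w
  proof
    assume "rep v = rep w"
    then have "orbit H act_eq v = orbit H act_eq w"
      using orb_eq[OF that(1) rep[OF that(1)]] orb_eq[OF that(2) rep[OF that(2)]] by simp
    then show "v \<in> orbit H act_eq w" using refl[OF that(1)] by simp
  next
    assume "v \<in> orbit H act_eq w"
    then show "rep v = rep w" using orb_eq[OF that(2)] by (simp add: rep_def)
  qed
  have rep_sum: "(\<Sum>w\<in>T. Poly_Mapping.single (rep w) (?c w)) = 0"
  proof (rule poly_mapping_eqI)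
    fix u
    have "(\<Sum>w\<in>T. ?c w when rep w = u) = (\<Sum>w\<in>{w\<in>T. rep w = u}. ?c w)"
      using T(1) by (simp add: when_def sum.inter_filter)
    also have "\<dots> = 0"
    proof (cases "\<exists>w\<in>T. rep w = u")
      case True
      then obtain w where w: "w \<in> T" "rep w = u" by blast
      then have "orbit H act_eq w \<in> set Ws" using T(2) Ws by (auto simp: orbits_def)
      then obtain i where i: "i < length Ws" "Ws ! i = orbit H act_eq w"
        by (auto simp: in_set_conv_nth)
      \<comment> \<open>The coefficient at a representative is the sum of the coefficients of
        \<open>z\<close> over its orbit, that is, a component of \<open>Omega Ws z\<close>.\<close>
      have "{v\<in>T. rep v = u} = T \<inter> Ws ! i"
        using rep_cong w T(2) i(2) by blast
      then show ?thesis using Omega_z[of i] i(1) by (simp add: Omega_def T_def)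
    qed (auto intro!: sum.neutral)
    finally show "Poly_Mapping.lookup (\<Sum>w\<in>T. Poly_Mapping.single (rep w) (?c w)) u
        = Poly_Mapping.lookup 0 u"
      by (simp add: lookup_sum lookup_single)
  qed
  have "\<exists>\<kappa>\<in>carrier H. act_eq \<kappa> w = rep w" if "w \<in> T" for w
    using rep[of w] that T(2) by (auto simp: orbit_def)
  then obtain \<kappa> where \<kappa>: "\<And>w. w \<in> T \<Longrightarrow> \<kappa> w \<in> carrier H \<and> act_eq (\<kappa> w) w = rep w" by metis

  \<comment> \<open>There is one error below \<open>1 / n\<close> for each element of
    \<open>T\<close>, and their total must stay below the separation \<open>1 / 4\<close>. The
    \<open>+ 1\<close> makes this strict and keeps \<open>n\<close> positive for empty
    \<open>T\<close>.\<close>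
  define n where "n = 4 * card T + 1"
  have n: "n > 0" by (simp add: n_def)
  define col where
    "col h w = nat \<lfloor>real n * frac (f (Poly_Mapping.single (act_eq h w) (?c w)))\<rfloor>" for h w
  have col_lt: "col h w < n" for h w
  proof -
    have "real n * frac (f (Poly_Mapping.single (act_eq h w) (?c w))) < real n"
      using frac_lt_1 by (simp add: n_def)
    then show ?thesis unfolding col_def by (simp add: floor_less_iff nat_less_iff n_def)
  qed
  \<comment> \<open>A colour is a whole tuple of arc indices, one for each element of
    \<open>T\<close>; it is coded as a number so that one application of the Ramsey property
    controls all terms.\<close>
  have "finite (T \<rightarrow>\<^sub>E {..<n})" using T(1) by (intro finite_PiE) auto
  then obtain e :: "_ \<Rightarrow> nat" and k where e: "e ` (T \<rightarrow>\<^sub>E {..<n}) = {i. i < k}"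
      "inj_on e (T \<rightarrow>\<^sub>E {..<n})"
    using finite_imp_inj_to_nat_seg by metis
  define \<chi> where "\<chi> h = e (restrict (col h) T)" for h
  have colE: "restrict (col h) T \<in> T \<rightarrow>\<^sub>E {..<n}" for h using col_lt by simp
  have \<chi>k: "\<chi> h < k" for h
    using imageI[OF colE[of h], of e] unfolding e(1) by (simp add: \<chi>_def)
  \<comment> \<open>Supporting \<open>T\<close> makes the colouring depend on values on
    \<open>A\<close>; supporting the keys of \<open>x\<close> puts the pointwise stabiliser of
    \<open>A\<close> inside \<open>H\<close>.\<close>
  obtain A where A: "finite A" "A \<subseteq> univ M"
    and supp: "\<And>g h w. g \<in> carrier ?G \<Longrightarrow> h \<in> carrier ?G \<Longrightarrow> \<forall>a\<in>A. g a = h a \<Longrightarrow>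
      w \<in> T \<union> Poly_Mapping.keys x \<Longrightarrow> act_eq g w = act_eq h w"
  proof -
    have "finite (T \<union> Poly_Mapping.keys x)" "T \<union> Poly_Mapping.keys x \<subseteq> imaginaries L M"
      using T xW WI by auto
    from act_eq_support_finite[OF M this] show ?thesis using that by metis
  qed
  have HA: "g \<in> carrier H" if g: "g \<in> carrier ?G" "\<forall>a\<in>A. g a = a" for g
  proof -
    have "\<forall>a\<in>A. g a = \<one>\<^bsub>?G\<^esub> a" using g(2) A(2) by (auto simp: Aut_one_apply)
    then have "act_eq g w = w" if "w \<in> Poly_Mapping.keys x" for w
      using supp[OF g(1) one_closed, of w] that act_eq_one[of w L M] xW WI by auto
    then show ?thesis using g(1) by (simp add: H)
  qed
  have \<chi>A: "\<chi> g = \<chi> h" if gh: "g \<in> carrier H" "h \<in> carrier H" "\<forall>a\<in>A. g a = h a" for g h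
  proof -
    have "act_eq g w = act_eq h w" if "w \<in> T" for w
      using that HG gh(1,2) by (intro supp[OF _ _ gh(3)]) auto
    then have "restrict (col g) T = restrict (col h) T"
      by (intro restrict_ext) (simp add: col_def)
    then show ?thesis by (simp add: \<chi>_def)
  qed
  \<comment> \<open>The identity is included so that \<open>h\<close> itself shares the common
    colour. Comparing it with the product of \<open>h\<close> and \<open>\<kappa> w\<close> at index
    \<open>w\<close> compares \<open>h w\<close> with \<open>h (rep w)\<close> under the same
    coefficient.\<close>
  have K: "finite (insert \<one>\<^bsub>?G\<^esub> (\<kappa> ` T))" "insert \<one>\<^bsub>?G\<^esub> (\<kappa> ` T) \<subseteq> carrier H"
    using T(1) \<kappa> subgroup.one_closed[OF sub] by auto
  obtain h i where h: "h \<in> carrier H"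
    and i: "\<And>\<kappa>'. \<kappa>' \<in> insert \<one>\<^bsub>?G\<^esub> (\<kappa> ` T) \<Longrightarrow> \<chi> (h \<otimes>\<^bsub>?G\<^esub> \<kappa>') = i"
    by (rule Ramsey_open_subgroup[OF R A sub _ K, of \<chi> k]) (rule HA \<chi>k \<chi>A that; assumption)+
  have hG: "h \<in> carrier ?G" using h HG by blast
  have close: "\<exists>j :: int. \<bar>f (Poly_Mapping.single (act_eq h w) (?c w)) -
      f (Poly_Mapping.single (act_eq h (rep w)) (?c w)) - of_int j\<bar> < 1 / n" if w: "w \<in> T" for w
  proof -
    have "\<chi> (h \<otimes>\<^bsub>?G\<^esub> \<one>\<^bsub>?G\<^esub>) = \<chi> (h \<otimes>\<^bsub>?G\<^esub> \<kappa> w)" using i w by simp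
    then have "restrict (col h) T = restrict (col (h \<otimes>\<^bsub>?G\<^esub> \<kappa> w)) T"
      using hG by (intro inj_onD[OF e(2) _ colE colE]) (simp add: \<chi>_def)
    from fun_cong[OF this, of w] have "col h w = col (h \<otimes>\<^bsub>?G\<^esub> \<kappa> w) w"
      using w by simp
    moreover have "act_eq (h \<otimes>\<^bsub>?G\<^esub> \<kappa> w) w = act_eq h (rep w)"
      using actH[of w h "\<kappa> w"] \<kappa>[OF w] w T(2) h by auto
    ultimately have "\<lfloor>real n * frac (f (Poly_Mapping.single (act_eq h w) (?c w)))\<rfloor> =
        \<lfloor>real n * frac (f (Poly_Mapping.single (act_eq h (rep w)) (?c w)))\<rfloor>"
      by (simp add: col_def eq_nat_nat_iff)
    from close_mod_Ints[OF n this] show ?thesis by blast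
  qed
  let ?E = "\<Sum>w\<in>T. Poly_Mapping.single (act_eq h w) (?c w)"
  let ?E' = "\<Sum>w\<in>T. Poly_Mapping.single (act_eq h (rep w)) (?c w)"
  obtain j where "\<bar>f ?E - f ?E' - of_int j\<bar> \<le> real (card T) * (1 / n)"
    by (rule sum_close_mod_Ints[OF f _ close]) (use n in simp)
  moreover have "real (card T) * (1 / n) < 1 / 4" by (simp add: n_def field_simps)
  ultimately have small: "\<bar>f ?E - f ?E' - of_int j\<bar> < 1 / 4" by linarith
  \<comment> \<open>This vector is the image under \<open>h\<close> of a vanishing sum, so its
    character value is an integer.\<close>
  have "?E' = lin_act act_eq h (\<Sum>w\<in>T. Poly_Mapping.single (rep w) (?c w))"
    by (simp add: lin_act_sum)
  then have "?E' \<in> U" using rep_sum \<open>0 \<in> U\<close> by simp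
  then obtain j1 where j1: "f ?E' = of_int j1" using fU Ints_cases by blast
  have hx: "lin_act act_eq h x = x" using h by (intro lin_act_id) (auto simp: H)
  have "?E + x = lin_act act_eq h (z + x)"
    using hx by (simp add: lin_act_add lin_act_def[of _ _ z] T_def)
  also have "\<dots> = lin_act act_eq h y" by (simp add: z_def)
  finally have "f (?E + x) \<in> \<int>" using fU RG_submodule_act[OF U hG y] by simp
  then obtain j2 where j2: "f (?E + x) = of_int j2" using Ints_cases by blast
  obtain j3 where j3: "f (?E + x) - f ?E - f x = of_int j3" using f Ints_cases by blast
  \<comment> \<open>Since \<open>?E + x\<close> is \<open>h y\<close> and lies in \<open>U\<close>,
    the value at \<open>?E\<close> is minus the value at \<open>x\<close> modulo integers. Hence the
    small difference places \<open>f x\<close> closer than \<open>1 / 4\<close> to an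
    integer.\<close>
  have "f ?E - f ?E' - of_int j = - (f x - of_int (j2 - j3 - j1 - j))"
    using j1 j2 j3 by simp
  then have "\<bar>f x - of_int (j2 - j3 - j1 - j)\<bar> < 1 / 4"
    using small by (simp only: abs_minus_cancel)
  then show False using fx[of "j2 - j3 - j1 - j"] by linarith
qed

text \<open>The \<open>R\<close>-submodules of \<open>RW\<close>, with the group forgotten, so that
  linearity of \<open>Omega\<close> suffices when passing from generators to their span.\<close>

definition R_closed :: "('w \<Rightarrow>\<^sub>0 'r::comm_ring) set \<Rightarrow> bool" where
  "R_closed U \<longleftrightarrow> 0 \<in> U \<and> (\<forall>x\<in>U. \<forall>y\<in>U. x + y \<in> U) \<and> (\<forall>r. \<forall>x\<in>U. smul r x \<in> U)"

lemma R_closed_hull: "R_closed (R_closed hull V)"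
  by (rule hull_in) (simp add: R_closed_def)

lemma R_closed_sum:
  "R_closed U \<Longrightarrow> (\<And>t. t \<in> T \<Longrightarrow> f t \<in> U) \<Longrightarrow> sum f T \<in> U"
  by (induction T rule: infinite_finite_induct) (auto simp: R_closed_def)

text \<open>Each group element acts linearly and permutes the generators, so it preserves their
  \<open>R\<close>-span. Applied to the union of the \<open>G\<close>-orbits of the given vectors,
  this bounds the \<open>RG\<close>-span by an \<open>R\<close>-span.\<close>

lemma R_closed_hull_RG_submodule:
  assumes V: "V \<subseteq> free_module W"
    and inv: "\<And>g v. g \<in> carrier G \<Longrightarrow> v \<in> V \<Longrightarrow> lin_act act g v \<in> V"
  shows "RG_submodule G act W (R_closed hull V)"
proof -
  let ?N = "R_closed hull V"
  have N: "R_closed ?N" by (rule R_closed_hull)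
  have "R_closed (free_module W)"
    by (simp add: R_closed_def free_module_0 free_module_add free_module_smul)
  then have sub: "?N \<subseteq> free_module W" using V by (intro hull_minimal)
  have act: "lin_act act g x \<in> ?N" if g: "g \<in> carrier G" and "x \<in> ?N" for g x
  proof -
    have "R_closed {x. lin_act act g x \<in> ?N}"
      using N by (auto simp: R_closed_def lin_act_add lin_act_smul)
    moreover have "V \<subseteq> {x. lin_act act g x \<in> ?N}"
      using inv[OF g] by (auto intro: hull_inc)
    ultimately have "?N \<subseteq> {x. lin_act act g x \<in> ?N}" by (intro hull_minimal)
    then show ?thesis using that(2) by blast
  qed
  have "gr_act act a x \<in> ?N" if "a \<in> free_module (carrier G)" "x \<in> ?N" for a x
    unfolding gr_act_def
  proof (rule R_closed_sum[OF N])
    fix g assume "g \<in> Poly_Mapping.keys a"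
    then have "lin_act act g x \<in> ?N" using that act by (auto simp: free_module_def)
    then show "smul (Poly_Mapping.lookup a g) (lin_act act g x) \<in> ?N"
      using N by (simp add: R_closed_def)
  qed
  then show ?thesis using sub N by (simp add: RG_submodule_def R_closed_def)
qed

lemma R_submodule_hull_closed:
  shows "(\<lambda>i. 0) \<in> R_submodule l hull B"
    and "y \<in> R_submodule l hull B \<Longrightarrow> z \<in> R_submodule l hull B \<Longrightarrow>
      (\<lambda>i. y i + z i) \<in> R_submodule l hull B"
    and "y \<in> R_submodule l hull B \<Longrightarrow> (\<lambda>i. r * y i) \<in> R_submodule l hull B"
  by (simp_all add: hull_def R_submodule_def)

theorem theorem1p4:
  fixes L :: "('f, 'p) lang"
    and M :: "('m, 'f, 'p) fo_struct"
    and G H :: "('m \<Rightarrow> 'm) monoid"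
    and W S :: "'m list set set"
    and x :: "'m list set \<Rightarrow>\<^sub>0 'r::{comm_ring, comm_monoid_mult}"
    and vs :: "('m list set \<Rightarrow>\<^sub>0 'r) list"
    and V :: "('m list set \<Rightarrow>\<^sub>0 'r) set"
  assumes "omega_categorical L M"
    and "ramsey_structure L M"
    and "G = Aut L M"
    and "is_sort L M W"
    and "x \<in> free_module W"
    and "set vs \<subseteq> free_module W"
    and "S = Poly_Mapping.keys x"
    and "H = pointwise_stabilizer G act_eq S"
    and "V = (\<Union>v\<in>set vs. orbit G (lin_act act_eq) v)"
  shows "finite (orbits H W act_eq) \<and> finite (orbits H V (lin_act act_eq)) \<and>
    (\<forall>Ws us. distinct Ws \<and> set Ws = orbits H W act_eq \<and>
       representatives us (orbits H V (lin_act act_eq)) \<longrightarrow>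
       (x \<in> RG_submodule G act_eq W hull set vs \<longleftrightarrow>
        Omega Ws x \<in> R_submodule (length Ws) hull (Omega Ws ` set us)))"
proof -
  note W = assms(4) and x = assms(5) and vs = assms(6) and V = assms(9)
  have M: "is_struct L M" using assms(1) by (simp add: omega_categorical_def)
  interpret group G unfolding assms(3) using M by (rule group_Aut)
  have WI: "W \<subseteq> imaginaries L M" using is_sort_imaginaries[OF M W] .
  have SI: "S \<subseteq> imaginaries L M" using x WI by (auto simp: assms(7) free_module_def)
  have finS: "finite S" by (simp add: assms(7))
  have sub: "subgroup (carrier H) G"
    unfolding assms(8) assms(3) by (rule subgroup_stabilizer[OF M SI])
  have HG: "carrier H \<subseteq> carrier G" using sub by (rule subgroup.subset)
  obtain A where A: "finite A" "A \<subseteq> univ M"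
    and suppS: "\<And>g h w. g \<in> carrier G \<Longrightarrow> h \<in> carrier G \<Longrightarrow> \<forall>a\<in>A. g a = h a \<Longrightarrow>
      w \<in> S \<Longrightarrow> act_eq g w = act_eq h w"
    using act_eq_support_finite[OF M finS SI] unfolding assms(3) by metis
  have HA: "g \<in> carrier H" if g: "g \<in> carrier G" "\<forall>a\<in>A. g a = a" for g
  proof -
    have "\<forall>a\<in>A. g a = \<one>\<^bsub>G\<^esub> a" using g(2) A(2) by (auto simp: assms(3) Aut_one_apply)
    then have "act_eq g w = w" if "w \<in> S" for w
      using suppS[OF g(1) one_closed _ that] act_eq_one[of w L M] that SI by (auto simp: assms(3))
    then show ?thesis using g(1) by (simp add: assms(8))
  qed
  note fin = finite_orbits_on_orbit[OF assms(1) A sub[unfolded assms(3)]]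

  have lin_mult: "lin_act act_eq (g \<otimes>\<^bsub>G\<^esub> h) v = lin_act act_eq g (lin_act act_eq h v)"
    if "v \<in> free_module W" "g \<in> carrier G" "h \<in> carrier G" for g h and v :: "'m list set \<Rightarrow>\<^sub>0 'r"
    using that WI act_eq_mult[of _ L M g h] unfolding assms(3)
    by (intro lin_act_comp) (auto simp: free_module_def)
  have lin_one: "lin_act act_eq \<one>\<^bsub>G\<^esub> v = v" if "v \<in> free_module W" for v :: "'m list set \<Rightarrow>\<^sub>0 'r"
    using that WI act_eq_one[of _ L M] unfolding assms(3)
    by (intro lin_act_id) (auto simp: free_module_def)

  have finW: "finite (orbits H W act_eq)"
  proof -
    obtain Os where Os: "finite Os" "Os \<subseteq> orbits G (imaginaries L M) act_eq" "W = \<Union>Os"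
      using W unfolding is_sort_def assms(3) by metis
    have "finite (orbits H P act_eq)" if P: "P \<in> Os" for P
    proof -
      obtain w where w: "w \<in> imaginaries L M" "P = orbit (Aut L M) act_eq w"
        using P Os(2) by (auto simp: orbits_def assms(3))
      obtain B where B: "finite B" "B \<subseteq> univ M"
        "\<And>g h. g \<in> carrier (Aut L M) \<Longrightarrow> h \<in> carrier (Aut L M) \<Longrightarrow> \<forall>a\<in>B. g a = h a \<Longrightarrow>
          act_eq g w = act_eq h w"
        using act_eq_support[OF M w(1)] by metis
      show ?thesis unfolding w(2)
        by (rule fin[OF HA[unfolded assms(3)] B act_eq_mult[OF w(1)]])
    qed
    then show ?thesis unfolding Os(3) by (rule finite_orbits_Union[OF Os(1)])
  qed
  have finV: "finite (orbits H V (lin_act act_eq))"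
    unfolding V
  proof (rule finite_orbits_Union)
    fix P assume "P \<in> orbit G (lin_act act_eq) ` set vs"
    then obtain v where v: "v \<in> set vs" "P = orbit (Aut L M) (lin_act act_eq) v"
      by (auto simp: assms(3))
    have vW: "v \<in> free_module W" using v vs by blast
    then have "Poly_Mapping.keys v \<subseteq> imaginaries L M" using WI by (auto simp: free_module_def)
    then obtain B where B: "finite B" "B \<subseteq> univ M"
      "\<And>g h w. g \<in> carrier (Aut L M) \<Longrightarrow> h \<in> carrier (Aut L M) \<Longrightarrow> \<forall>a\<in>B. g a = h a \<Longrightarrow>
        w \<in> Poly_Mapping.keys v \<Longrightarrow> act_eq g w = act_eq h w"
      using act_eq_support_finite[OF M finite_keys] by metis
    show "finite (orbits H P (lin_act act_eq))"
      unfolding v(2)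
    proof (rule fin[OF _ B(1,2)])
      show "lin_act act_eq g v = lin_act act_eq h v"
        if "g \<in> carrier (Aut L M)" "h \<in> carrier (Aut L M)" "\<forall>b\<in>B. g b = h b" for g h
        by (rule lin_act_cong) (rule B(3)[OF that])
    qed (use lin_mult[OF vW] HA in \<open>simp_all add: assms(3)\<close>)
  qed simp

  have VW: "V \<subseteq> free_module W"
  proof -
    have "lin_act act_eq g v \<in> free_module W" if "g \<in> carrier G" "v \<in> set vs" for g v
      using that vs is_sort_act[OF M W] unfolding assms(3)
      by (intro lin_act_in_free_module) (auto simp: free_module_def)
    then show ?thesis by (auto simp: V orbit_def)
  qed
  have Vinv: "lin_act act_eq g v \<in> V" if g: "g \<in> carrier G" and "v \<in> V" for g v
  proof -
    obtain u k where u: "u \<in> set vs" "k \<in> carrier G" "v = lin_act act_eq k u"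
      using \<open>v \<in> V\<close> by (auto simp: V orbit_def)
    then have "lin_act act_eq g v = lin_act act_eq (g \<otimes>\<^bsub>G\<^esub> k) u"
      using lin_mult[of u g k] g vs by auto
    then show ?thesis using u g orbitI[of "g \<otimes>\<^bsub>G\<^esub> k" G "lin_act act_eq" u] by (auto simp: V)
  qed
  have vsV: "set vs \<subseteq> V"
  proof
    fix v assume v: "v \<in> set vs"
    then have "v \<in> orbit G (lin_act act_eq) v"
      using orbitI[of "\<one>\<^bsub>G\<^esub>" G "lin_act act_eq" v] lin_one vs by auto
    then show "v \<in> V" using v by (auto simp: V)
  qed

  have "x \<in> RG_submodule G act_eq W hull set vs \<longleftrightarrow>
      Omega Ws x \<in> R_submodule (length Ws) hull (Omega Ws ` set us)"
    if Ws: "set Ws = orbits H W act_eq" and us: "representatives us (orbits H V (lin_act act_eq))"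
    for Ws us
  proof
    assume xN: "x \<in> RG_submodule G act_eq W hull set vs"
    let ?Q = "R_submodule (length Ws) hull (Omega Ws ` set us)"
    have "RG_submodule G act_eq W (R_closed hull V)"
      using VW Vinv by (rule R_closed_hull_RG_submodule)
    moreover have "set vs \<subseteq> R_closed hull V" using vsV by (auto intro: hull_inc)
    ultimately have xV: "x \<in> R_closed hull V"
      using xN hull_minimal[of "set vs" "R_closed hull V" "RG_submodule G act_eq W"] by blast
    have inv: "act_eq h w \<in> Ws ! i \<longleftrightarrow> w \<in> Ws ! i"
      if h: "h \<in> carrier H" and w: "w \<in> W" and i: "i < length Ws" for h w i
    proof -
      obtain u where u: "u \<in> W" "Ws ! i = orbit H act_eq u"
        using Ws i by (force simp: orbits_def dest: nth_mem)
      have orb_eq: "orbit H act_eq q = orbit H act_eq p"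
        if p: "p \<in> W" and "q \<in> orbit H act_eq p" for p q
      proof (rule orbit_mem_eq[OF group_axioms sub _ _ that(2)])
        have pI: "p \<in> imaginaries L M" using p WI by blast
        show "act_eq (g \<otimes>\<^bsub>G\<^esub> h) p = act_eq g (act_eq h p)"
          if "g \<in> carrier H" "h \<in> carrier H" for g h
          using that HG unfolding assms(3) by (intro act_eq_mult[OF pI]) auto
        show "act_eq \<one>\<^bsub>G\<^esub> p = p" unfolding assms(3) by (rule act_eq_one[OF pI])
      qed
      have refl: "p \<in> orbit H act_eq p" if "p \<in> W" for p
        using orbitI[of "\<one>\<^bsub>G\<^esub>" H act_eq p] subgroup.one_closed[OF sub] act_eq_one[of p L M] that WI
        by (auto simp: assms(3))
      have hw: "act_eq h w \<in> W" using is_sort_act[OF M W _ w] h HG by (auto simp: assms(3))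
      have "orbit H act_eq (act_eq h w) = orbit H act_eq w"
        using orb_eq[OF w orbitI[of h H act_eq w]] h by simp
      then show ?thesis using refl[OF w] refl[OF hw] orb_eq[OF u(1)] u(2) by metis
    qed
    \<comment> \<open>Some representative is the image of \<open>v\<close> under an element of
      \<open>H\<close>, and \<open>Omega\<close> cannot tell the two apart.\<close>
    have "Omega Ws v \<in> ?Q" if v: "v \<in> V" for v
    proof -
      have vW: "v \<in> free_module W" using v VW by blast
      have "orbit H (lin_act act_eq) v \<in> orbits H V (lin_act act_eq)"
        using v by (auto simp: orbits_def)
      then obtain i where i: "i < length us" "us ! i \<in> orbit H (lin_act act_eq) v"
        using us unfolding representatives_def by blast
      then obtain h where h: "h \<in> carrier H" "us ! i = lin_act act_eq h v"
        by (auto simp: orbit_def)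
      have "Omega Ws (us ! i) = Omega Ws v"
        unfolding h(2) using inv[OF h(1)] vW by (intro Omega_lin_act) (auto simp: free_module_def)
      then show ?thesis using i(1) by (metis hull_inc imageI nth_mem)
    qed
    moreover have "R_closed {v. Omega Ws v \<in> ?Q}"
      by (simp add: R_closed_def Omega_add Omega_smul R_submodule_hull_closed)
    ultimately have "R_closed hull V \<subseteq> {v. Omega Ws v \<in> ?Q}"
      by (intro hull_minimal) auto
    then show "Omega Ws x \<in> ?Q" using xV by blast
  next
    assume Ox: "Omega Ws x \<in> R_submodule (length Ws) hull (Omega Ws ` set us)"
    show "x \<in> RG_submodule G act_eq W hull set vs"
      unfolding hull_def
    proof (intro InterI, clarify)
      fix U assume U: "RG_submodule G act_eq W U" and vsU: "set vs \<subseteq> U"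
      have UW: "U \<subseteq> free_module W" using U by (simp add: RG_submodule_def)
      have VU: "V \<subseteq> U"
        using RG_submodule_act[OF U] vsU by (auto simp: V orbit_def)
      \<comment> \<open>As the image of \<open>U\<close> is a submodule containing the images of
        \<open>us\<close>, it contains \<open>Omega Ws x\<close>; this produces the \<open>y\<close>
        in \<open>U\<close> with the same image as \<open>x\<close>.\<close>
      have "R_submodule (length Ws) (Omega Ws ` U)"
        unfolding R_submodule_def
      proof (intro conjI ballI allI)
        show "Omega Ws ` U \<subseteq> {y. \<forall>i\<ge>length Ws. y i = 0}" by (auto simp: Omega_def)
        show "(\<lambda>i. 0) \<in> Omega Ws ` U"
          using U by (auto simp: RG_submodule_def intro!: image_eqI[of _ _ 0])
      next
        fix y z assume "y \<in> Omega Ws ` U" "z \<in> Omega Ws ` U"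
        then obtain a b where "a \<in> U" "b \<in> U" "y = Omega Ws a" "z = Omega Ws b" by blast
        moreover from this have "a + b \<in> U" using U by (simp add: RG_submodule_def)
        ultimately show "(\<lambda>i. y i + z i) \<in> Omega Ws ` U"
          using Omega_add[of Ws a b] by (metis imageI)
      next
        fix r y assume "y \<in> Omega Ws ` U"
        then obtain a where a: "a \<in> U" "y = Omega Ws a" by blast
        then have "smul r a \<in> U"
          using RG_submodule_smul_act[OF U one_closed a(1), of r] lin_one UW by auto
        then show "(\<lambda>i. r * y i) \<in> Omega Ws ` U"
          using a(2) Omega_smul[of Ws r a] by (metis imageI)
      qed
      moreover have "set us \<subseteq> U"
      proof
        fix u assume "u \<in> set us"
        then obtain v where "v \<in> V" "u \<in> orbit H (lin_act act_eq) v"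
          using us by (force simp: representatives_def orbits_def)
        then show "u \<in> U" using Vinv HG VU by (auto simp: orbit_def)
      qed
      ultimately have "R_submodule (length Ws) hull (Omega Ws ` set us) \<subseteq> Omega Ws ` U"
        by (intro hull_minimal image_mono)
      then obtain y where y: "y \<in> U" "Omega Ws x = Omega Ws y" using Ox by blast
      show "x \<in> U"
        using mem_submodule_if_Omega_eq[OF assms(2) W x _ Ws _ y] assms(3,7,8) U by simp
    qed
  qed
  then show ?thesis using finW finV by blast
qed

end
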